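(* Let $U$ be an open subset of $\mathbb C$ containing $0$. Let $A$ and $B$ be unital complex Banach algebras, and let $\pi:U\to\mathcal B(A,B)$ be an analytic map whose values are unit-preserving homomorphisms $A\to B$, such that $\pi(0)$ is surjective. Suppose that the spectrum (in $A$) of each element of $\operatorname{Ker}\pi(0)$ is $\{0\}$. Let $b(\cdot):U\to E_p(B)\ (\subset B)$ be an analytic map. Then there exist an open set $V\subset\mathbb C$ with $0\in V\subset U$ and an analytic map $a(\cdot):V\to E_p(A)\ (\subset A)$ such that $$\pi(\lambda)a(\lambda)=b(\lambda)\quad\text{for each }\lambda\in V.$$
   Context: All Banach algebras have a unit of norm $1$. Fix an integer $n\ge2$, distinct $\lambda_1,\dots,\lambda_n\in\mathbb C$, and let $p(\lambda)=\prod_{i=1}^n(\lambda-\lambda_i)$. For a unital complex Banach algebra $A$, $E_p(A)=\{a\in A\mid p(a)=0\}$. $\mathcal B(A,B)$ is the Banach space of all bounded linear operators $A\to B$. A map into $E_p(A)$ is analytic if it is analytic as a map into $A$. Homomorphism means Banach algebra homomorphism. *)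

theory Defs
  imports "HOL-Analysis.Analysis" "HOL-Computational_Algebra.Polynomial"
begin

class complex_normed_vector = real_normed_vector +
  fixes scaleC :: "complex \<Rightarrow> 'a \<Rightarrow> 'a"  (infixr "*\<^sub>C" 75)
  assumes scaleC_add_right: "c *\<^sub>C (x + y) = c *\<^sub>C x + c *\<^sub>C y"
    and scaleC_add_left: "(c + d) *\<^sub>C x = c *\<^sub>C x + d *\<^sub>C x"
    and scaleC_scaleC: "c *\<^sub>C d *\<^sub>C x = (c * d) *\<^sub>C x"
    and scaleC_of_real: "complex_of_real r *\<^sub>C x = r *\<^sub>R x"
    and norm_scaleC: "norm (c *\<^sub>C x) = cmod c * norm x"

text \<open>
  Submultiplicativity of the norm and \<open>norm 1 = 1\<close> (so \<open>1 \<noteq> 0\<close>) come from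
  \<open>real_normed_algebra_1\<close>, completeness from \<open>banach\<close>; commutativity is not assumed.
\<close>
class complex_banach_algebra_1 = complex_normed_vector + real_normed_algebra_1 + banach +
  assumes mult_scaleC_left: "(c *\<^sub>C x) * y = c *\<^sub>C (x * y)"
    and mult_scaleC_right: "x * (c *\<^sub>C y) = c *\<^sub>C (x * y)"

instantiation complex :: complex_banach_algebra_1
begin

definition scaleC_complex :: "complex \<Rightarrow> complex \<Rightarrow> complex"
  where "scaleC_complex c x = c * x"

instance
  by standard (simp_all add: scaleC_complex_def algebra_simps norm_mult scaleR_conv_of_real)

end

lemma bounded_linear_scaleC_right: "bounded_linear (\<lambda>x::'a::complex_normed_vector. c *\<^sub>C x)"
proof (rule bounded_linear_intro[where K = "cmod c"])
  fix r :: real and x :: 'a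
  have "c *\<^sub>C r *\<^sub>R x = (c * of_real r) *\<^sub>C x"
    by (metis scaleC_of_real scaleC_scaleC)
  also have "\<dots> = r *\<^sub>R c *\<^sub>C x"
    by (metis scaleC_of_real scaleC_scaleC mult.commute)
  finally show "c *\<^sub>C r *\<^sub>R x = r *\<^sub>R c *\<^sub>C x" .
qed (simp_all add: scaleC_add_right norm_scaleC mult.commute)

text \<open>
  \<open>'a \<Rightarrow>\<^sub>L 'b\<close> consists of the bounded \<^emph>\<open>real\<close>-linear maps, with the operator norm.
  The scalar action on values makes it a complex normed space in which the bounded
  complex-linear maps form a closed complex subspace; an analytic map with values in that
  subspace has its power series coefficients there as well.
\<close>
instantiation blinfun :: (real_normed_vector, complex_normed_vector) complex_normed_vector
begin

lift_definition scaleC_blinfun :: "complex \<Rightarrow> ('a \<Rightarrow>\<^sub>L 'b) \<Rightarrow> ('a \<Rightarrow>\<^sub>L 'b)"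
  is "\<lambda>c f x. c *\<^sub>C f x"
  by (rule bounded_linear_compose[OF bounded_linear_scaleC_right])

instance
proof
  fix c d :: complex and r :: real and f g :: "'a \<Rightarrow>\<^sub>L 'b"
  show "c *\<^sub>C (f + g) = c *\<^sub>C f + c *\<^sub>C g"
    by transfer (simp add: scaleC_add_right)
  show "(c + d) *\<^sub>C f = c *\<^sub>C f + d *\<^sub>C f"
    by transfer (simp add: scaleC_add_left)
  show "c *\<^sub>C d *\<^sub>C f = (c * d) *\<^sub>C f"
    by transfer (simp add: scaleC_scaleC)
  show "complex_of_real r *\<^sub>C f = r *\<^sub>R f"
    by transfer (simp add: scaleC_of_real)
  show "norm (c *\<^sub>C f) = cmod c * norm f"
  proof (rule antisym)
    have le: "norm (k *\<^sub>C h) \<le> cmod k * norm h" for k and h :: "'a \<Rightarrow>\<^sub>L 'b"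
    proof (rule norm_blinfun_bound)
      fix x
      have "norm (blinfun_apply (k *\<^sub>C h) x) = cmod k * norm (h x)"
        by (simp add: scaleC_blinfun.rep_eq norm_scaleC)
      also have "\<dots> \<le> cmod k * (norm h * norm x)"
        by (intro mult_left_mono norm_blinfun) auto
      finally show "norm (blinfun_apply (k *\<^sub>C h) x) \<le> cmod k * norm h * norm x"
        by (simp add: mult.assoc)
    qed simp
    show "norm (c *\<^sub>C f) \<le> cmod c * norm f" by (rule le)
    show "cmod c * norm f \<le> norm (c *\<^sub>C f)"
    proof (cases "c = 0")
      case False
      have "inverse c *\<^sub>C c *\<^sub>C f = f"
      proof (rule blinfun_eqI)
        fix x
        have "inverse c *\<^sub>C c *\<^sub>C f x = complex_of_real 1 *\<^sub>C f x"
          using False by (simp add: scaleC_scaleC)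
        then show "blinfun_apply (inverse c *\<^sub>C c *\<^sub>C f) x = f x"
          by (simp only: scaleC_blinfun.rep_eq scaleC_of_real scaleR_one)
      qed
      then have "norm f \<le> cmod (inverse c) * norm (c *\<^sub>C f)"
        by (metis le)
      with False show ?thesis
        by (simp add: norm_inverse norm_divide field_simps)
    qed simp
  qed
qed

end

text \<open>
  Local expansion into norm-convergent power series.  For open \<open>S\<close> only the values
  of \<open>f\<close> on \<open>S\<close> matter, since the radius may be shrunk.
\<close>
definition vec_analytic_on :: "(complex \<Rightarrow> 'a::complex_normed_vector) \<Rightarrow> complex set \<Rightarrow> bool"
    (infix "vec'_analytic'_on" 50)
  where "f vec_analytic_on S \<longleftrightarrow>
    (\<forall>z\<in>S. \<exists>c r. r > 0 \<and> (\<forall>w\<in>ball z r. (\<lambda>k. (w - z) ^ k *\<^sub>C c k) sums f w))"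

text \<open>
  Boundedness and additivity are part of the type \<open>'a \<Rightarrow>\<^sub>L 'b\<close>; complex homogeneity is not.
\<close>
definition unital_banach_hom ::
    "('a::complex_banach_algebra_1 \<Rightarrow>\<^sub>L 'b::complex_banach_algebra_1) \<Rightarrow> bool"
  where "unital_banach_hom f \<longleftrightarrow>
    (\<forall>c x. f (c *\<^sub>C x) = c *\<^sub>C f x) \<and> (\<forall>x y. f (x * y) = f x * f y) \<and> f 1 = 1"

definition spectrum :: "'a::complex_banach_algebra_1 \<Rightarrow> complex set"
  where "spectrum a = {\<mu>. \<not> (\<exists>y. (\<mu> *\<^sub>C 1 - a) * y = 1 \<and> y * (\<mu> *\<^sub>C 1 - a) = 1)}"

definition alg_poly :: "complex poly \<Rightarrow> 'a::complex_banach_algebra_1 \<Rightarrow> 'a"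
  where "alg_poly p a = (\<Sum>i\<le>degree p. coeff p i *\<^sub>C a ^ i)"

definition alg_roots :: "complex poly \<Rightarrow> 'a::complex_banach_algebra_1 set"
  where "alg_roots p = {a. alg_poly p a = 0}"

end

theory Submission
  imports Defs
begin

text \<open>
  Write \<open>p\<close> for the product of the \<open>\<lambda> - lam i\<close>.  Roots of \<open>p\<close> in a Banach algebra
  correspond to families of complete orthogonal idempotents: the root is
  \<open>a = \<Sum>i. lam i e i\<close>, and the \<open>e i\<close> are the Lagrange basis polynomials evaluated at
  \<open>a\<close>.  This reduces the theorem to the lifting of idempotents at the single point \<open>0\<close>,
  followed by an analytic conjugation.

  At the point \<open>0\<close>, the idempotents of \<open>b 0\<close> are lifted to \<open>A\<close>
  (\<open>lift_spectral_idempotents\<close>).  An arbitrary preimage \<open>x\<close> of an idempotent has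
  \<open>x\<^sup>2 - x\<close> in the kernel of \<open>\<pi> 0\<close>, so the powers of every multiple of this element
  are bounded (\<open>spectrum_in_unit_ball_imp_power_bounded\<close>) and the binomial series that corrects
  \<open>x\<close> to an idempotent converges (\<open>idempotent_lift\<close>).  The lifted idempotents are orthogonal
  and complete because an idempotent with spectrum \<open>{0}\<close> vanishes.  Let \<open>a0\<close> be the
  resulting root of \<open>p\<close> in \<open>A\<close> over \<open>b 0\<close>.

  Near \<open>0\<close>, put \<open>S z = \<Sum>i. f i z * \<pi> z (e i)\<close>, where the \<open>f i z\<close> are the idempotents
  of \<open>b z\<close>.  Then \<open>S 0 = 1\<close> and \<open>b z * S z = S z * \<pi> z a0\<close>.  If \<open>s\<close> is an analytic
  family with \<open>\<pi> z (s z) = S z\<close> and \<open>s 0 = 1\<close>, then \<open>s z\<close> is invertible for small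
  \<open>z\<close>, and \<open>a z = s z * a0 * (s z)\<^sup>-\<^sup>1\<close> is a root of \<open>p\<close> that \<open>\<pi> z\<close> maps to
  \<open>b z\<close>.

  The family \<open>s\<close> is provided by \<open>vec_analytic_lift\<close>: an equation \<open>P z (t z) = S z\<close> with
  analytic operators \<open>P z\<close> and \<open>P 0\<close> onto is solved coefficient by coefficient, the open
  mapping theorem controlling the growth of the coefficients.  Applied to multiplication by
  \<open>s z\<close>, the same lemma yields a right inverse of \<open>s z\<close> and the conjugate \<open>a z\<close>
  analytically in \<open>z\<close>.
\<close>

section \<open>Complex scalars and polynomials in a Banach algebra\<close>

lemma bounded_bilinear_scaleC:
  "bounded_bilinear (\<lambda>c (x::'a::complex_normed_vector). c *\<^sub>C x)"
proof
  show "\<exists>K. \<forall>a (b::'a). norm (a *\<^sub>C b) \<le> norm a * norm b * K"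
    by (rule exI[of _ 1]) (simp add: norm_scaleC)
  fix r :: real and a and b :: 'a
  show "(r *\<^sub>R a) *\<^sub>C b = r *\<^sub>R a *\<^sub>C b"
    by (metis scaleC_of_real scaleC_scaleC scaleR_conv_of_real)
  show "a *\<^sub>C r *\<^sub>R b = r *\<^sub>R a *\<^sub>C b"
    by (metis scaleC_of_real scaleC_scaleC mult.commute)
qed (simp_all add: scaleC_add_left scaleC_add_right)

interpretation scaleC: bounded_bilinear "\<lambda>c (x::'a::complex_normed_vector). c *\<^sub>C x"
  by (rule bounded_bilinear_scaleC)

lemma scaleC_one [simp]: "1 *\<^sub>C x = (x::'a::complex_normed_vector)"
  by (metis of_real_1 scaleC_of_real scaleR_one)

lemma sum_eq_single:
  assumes "finite A" "i \<in> A" "\<And>j. j \<in> A \<Longrightarrow> j \<noteq> i \<Longrightarrow> g j = (0::'a::comm_monoid_add)"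
  shows "sum g A = g i"
  using assms by (simp add: sum.remove[of A i] sum.neutral)

lemma power_scaleC:
  "(c *\<^sub>C x) ^ k = c ^ k *\<^sub>C (x::'a::complex_banach_algebra_1) ^ k"
  by (induction k) (simp_all add: mult_scaleC_left mult_scaleC_right scaleC_scaleC mult.commute)

lemma alg_poly_0 [simp]: "alg_poly 0 x = 0"
  by (simp add: alg_poly_def scaleC.zero_left)

lemma alg_poly_pCons:
  "alg_poly (pCons a p) x = a *\<^sub>C 1 + x * alg_poly p x"
proof (cases "p = 0")
  case False
  have "alg_poly (pCons a p) x = (\<Sum>i\<le>Suc (degree p). coeff (pCons a p) i *\<^sub>C x ^ i)"
    using False by (simp add: alg_poly_def)
  also have "\<dots> = a *\<^sub>C 1 + x * alg_poly p x"
    by (simp add: sum.atMost_Suc_shift alg_poly_def sum_distrib_left mult_scaleC_right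
        del: sum.atMost_Suc)
  finally show ?thesis .
qed (simp add: alg_poly_def scaleC.zero_left)

lemma alg_poly_1 [simp]: "alg_poly 1 x = 1"
  by (simp add: one_pCons alg_poly_pCons)

lemma alg_poly_add: "alg_poly (p + q) x = alg_poly p x + alg_poly q x"
  by (induction p q rule: poly_induct2)
    (simp_all add: alg_poly_pCons scaleC_add_left distrib_left)

lemma alg_poly_smult: "alg_poly (smult c p) x = c *\<^sub>C alg_poly p x"
  by (induction p) (simp_all add: alg_poly_pCons scaleC_add_right scaleC_scaleC mult_scaleC_right
      scaleC.zero_right)

lemma alg_poly_mult: "alg_poly (p * q) x = alg_poly p x * alg_poly q x"
  by (induction p)
    (simp_all add: alg_poly_pCons alg_poly_add alg_poly_smult distrib_right mult_scaleC_left
      mult.assoc scaleC.zero_left)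

lemma alg_poly_sum: "alg_poly (\<Sum>i\<in>I. f i) x = (\<Sum>i\<in>I. alg_poly (f i) x)"
  by (induction I rule: infinite_finite_induct) (simp_all add: alg_poly_add)

lemma alg_poly_linear [simp]: "alg_poly [:- c, 1:] x = x - c *\<^sub>C 1"
  by (simp add: alg_poly_pCons scaleC.minus_left)

lemma alg_poly_commute:
  assumes "y * x = x * y"
  shows "y * alg_poly p x = alg_poly p x * y"
proof (induction p)
  case (pCons a p)
  have "y * (x * alg_poly p x) = x * (y * alg_poly p x)"
    by (metis assms mult.assoc)
  with pCons show ?case
    by (simp add: alg_poly_pCons distrib_left distrib_right mult_scaleC_left mult_scaleC_right
        mult.assoc)
qed simp

lemma unital_banach_hom_alg_poly:
  assumes "unital_banach_hom f"
  shows "f (alg_poly p x) = alg_poly p (f x)"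
  using assms
  by (induction p) (simp_all add: alg_poly_pCons unital_banach_hom_def blinfun.add_right)

lemma alg_poly_eq_0_if_dvd:
  assumes "alg_poly p x = 0" "p dvd q"
  shows "alg_poly q x = 0"
  using assms by (auto simp: alg_poly_mult)

lemma alg_poly_conj:
  assumes "a * s = s * c"
  shows "alg_poly p a * s = s * alg_poly p c"
proof (induction p)
  case (pCons k p)
  have "a * alg_poly p a * s = s * (c * alg_poly p c)"
    by (metis assms mult.assoc pCons.IH)
  then show ?case
    by (simp add: alg_poly_pCons distrib_left distrib_right mult_scaleC_left mult_scaleC_right)
qed simp

definition lagrange_basis :: "(nat \<Rightarrow> complex) \<Rightarrow> nat \<Rightarrow> nat \<Rightarrow> complex poly"
  where "lagrange_basis lam n i =
    (\<Prod>j\<in>{1..n} - {i}. smult (inverse (lam i - lam j)) [:- lam j, 1:])"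

lemma linear_mult_lagrange_basis:
  assumes "i \<in> {1..n}"
  shows "[:- lam i, 1:] * lagrange_basis lam n i =
    smult (\<Prod>j\<in>{1..n} - {i}. inverse (lam i - lam j)) (\<Prod>i=1..n. [:- lam i, 1:])"
proof -
  have split: "(\<Prod>i=1..n. [:- lam i, 1:]) = [:- lam i, 1:] * (\<Prod>j\<in>{1..n} - {i}. [:- lam j, 1:])"
    by (rule prod.remove) (use assms in auto)
  show ?thesis
    unfolding split lagrange_basis_def prod_smult by (rule mult_smult_right)
qed

lemma prod_dvd_lagrange_basis_mult:
  assumes "i \<in> {1..n}" "j \<in> {1..n}" "i \<noteq> j"
  shows "(\<Prod>i=1..n. [:- lam i, 1:]) dvd lagrange_basis lam n i * lagrange_basis lam n j"
proof -
  have "(\<Prod>i=1..n. [:- lam i, 1:]) = [:- lam i, 1:] * (\<Prod>k\<in>{1..n} - {i}. [:- lam k, 1:])"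
    by (rule prod.remove) (use assms in auto)
  also have "\<dots> dvd lagrange_basis lam n j * lagrange_basis lam n i"
  proof (rule mult_dvd_mono)
    have "[:- lam i, 1:] dvd smult (inverse (lam j - lam i)) [:- lam i, 1:]"
      by (intro dvd_smult) simp
    also have "\<dots> dvd lagrange_basis lam n j"
      unfolding lagrange_basis_def using assms by (intro dvd_prodI) auto
    finally show "[:- lam i, 1:] dvd lagrange_basis lam n j" .
    show "(\<Prod>k\<in>{1..n} - {i}. [:- lam k, 1:]) dvd lagrange_basis lam n i"
      unfolding lagrange_basis_def prod_smult by (rule dvd_smult) simp
  qed
  finally show ?thesis
    by (simp add: mult.commute)
qed

lemma poly_lagrange_basis:
  assumes "inj_on lam {1..n}" "i \<in> {1..n}" "j \<in> {1..n}"
  shows "poly (lagrange_basis lam n i) (lam j) = (if i = j then 1 else 0)"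
proof -
  have eval: "poly (lagrange_basis lam n i) (lam j) =
      (\<Prod>k\<in>{1..n} - {i}. inverse (lam i - lam k) * (lam j - lam k))"
    by (simp add: lagrange_basis_def poly_prod algebra_simps)
  show ?thesis
  proof (cases "i = j")
    case True
    have "inverse (lam i - lam k) * (lam i - lam k) = 1" if "k \<in> {1..n} - {i}" for k
    proof -
      have "lam i \<noteq> lam k" using assms that by (auto dest: inj_onD)
      then show ?thesis by simp
    qed
    then show ?thesis
      using True unfolding eval by (metis (no_types, lifting) prod.neutral)
  next
    case False
    have "(\<Prod>k\<in>{1..n} - {i}. inverse (lam i - lam k) * (lam j - lam k)) = 0"
      by (rule prod_zero) (use False assms in auto)
    then show ?thesis
      using False eval by simp
  qed
qed

text \<open>
  The difference of the two sides has degree below \<open>n\<close> and the \<open>n\<close> distinct zeros \<open>lam j\<close>.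
\<close>
lemma sum_lagrange_basis:
  assumes "inj_on lam {1..n}" "n \<ge> 1"
  shows "(\<Sum>i=1..n. lagrange_basis lam n i) = 1"
proof (rule ccontr)
  assume neq: "(\<Sum>i=1..n. lagrange_basis lam n i) \<noteq> 1"
  define d where "d = (\<Sum>i=1..n. lagrange_basis lam n i) - 1"
  have "d \<noteq> 0" using neq by (simp add: d_def)
  have "degree (lagrange_basis lam n i) \<le> n - 1" if "i \<in> {1..n}" for i
  proof -
    have "degree (lagrange_basis lam n i)
        \<le> (\<Sum>j\<in>{1..n} - {i}. degree (smult (inverse (lam i - lam j)) [:- lam j, 1:]))"
      unfolding lagrange_basis_def by (rule degree_prod_sum_le[unfolded o_def]) simp
    also have "\<dots> \<le> (\<Sum>j\<in>{1..n} - {i}. 1)"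
      by (intro sum_mono) simp
    also have "\<dots> = n - 1"
      using that by simp
    finally show ?thesis .
  qed
  then have "degree d \<le> n - 1"
    unfolding d_def by (intro degree_diff_le degree_sum_le) auto
  have "poly d (lam j) = 0" if "j \<in> {1..n}" for j
    using that assms by (simp add: d_def poly_sum poly_lagrange_basis)
  then have "lam ` {1..n} \<subseteq> {x. poly d x = 0}" by auto
  then have "card (lam ` {1..n}) \<le> card {x. poly d x = 0}"
    using \<open>d \<noteq> 0\<close> by (intro card_mono poly_roots_finite) auto
  also have "\<dots> \<le> degree d"
    using \<open>d \<noteq> 0\<close> by (rule card_poly_roots_bound)
  finally show False
    using \<open>degree d \<le> n - 1\<close> assms by (simp add: card_image)
qed

text \<open>
  Each \<open>e i\<close> reduces \<open>a - lam i\<close> to \<open>0\<close>, hence kills \<open>p(a)\<close>; and the \<open>e i\<close> add up to \<open>1\<close>.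
\<close>
lemma alg_poly_sum_idempotents:
  fixes e :: "nat \<Rightarrow> 'a::complex_banach_algebra_1"
  assumes idem: "\<And>i. i \<in> {1..n} \<Longrightarrow> e i * e i = e i"
    and orth: "\<And>i j. i \<in> {1..n} \<Longrightarrow> j \<in> {1..n} \<Longrightarrow> i \<noteq> j \<Longrightarrow> e i * e j = 0"
    and total: "(\<Sum>i=1..n. e i) = 1"
    and a: "a = (\<Sum>i=1..n. lam i *\<^sub>C e i)"
  shows "alg_poly (\<Prod>i=1..n. [:- lam i, 1:]) a = 0"
    and "i \<in> {1..n} \<Longrightarrow> e i * a = lam i *\<^sub>C e i"
proof -
  let ?p = "\<Prod>i=1..n. [:- lam i, 1:]"
  have r: "a * e i = lam i *\<^sub>C e i" if i: "i \<in> {1..n}" for i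
  proof -
    have "a * e i = lam i *\<^sub>C e i * e i"
      unfolding a sum_distrib_right
      by (rule sum_eq_single[OF _ i])
        (simp_all add: mult_scaleC_left orth[OF _ i] scaleC.zero_right del: atLeastAtMost_iff)
    then show ?thesis by (simp only: mult_scaleC_left idem[OF i])
  qed
  show "e i * a = lam i *\<^sub>C e i" if i: "i \<in> {1..n}" for i
  proof -
    have "e i * a = e i * lam i *\<^sub>C e i"
      unfolding a sum_distrib_left
      by (rule sum_eq_single[OF _ i])
        (simp_all add: mult_scaleC_right orth[OF i _ not_sym] scaleC.zero_right del: atLeastAtMost_iff)
    then show ?thesis by (simp only: mult_scaleC_right idem[OF i])
  qed
  have "alg_poly ?p a * e i = 0" if "i \<in> {1..n}" for i
  proof -
    have "?p = (\<Prod>k\<in>{1..n} - {i}. [:- lam k, 1:]) * [:- lam i, 1:]"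
      unfolding mult.commute[of _ "[:- lam i, 1:]"] by (rule prod.remove) (use that in auto)
    then have "alg_poly ?p a * e i = alg_poly (\<Prod>k\<in>{1..n} - {i}. [:- lam k, 1:]) a * ((a - lam i *\<^sub>C 1) * e i)"
      by (simp only: alg_poly_mult mult.assoc alg_poly_linear)
    also have "(a - lam i *\<^sub>C 1) * e i = 0"
      using r[OF that] by (simp add: left_diff_distrib mult_scaleC_left)
    finally show ?thesis by simp
  qed
  then have "(\<Sum>i=1..n. alg_poly ?p a * e i) = 0"
    by (intro sum.neutral) auto
  then show "alg_poly ?p a = 0"
    by (simp only: sum_distrib_left[symmetric] total mult_1_right)
qed

text \<open>
  Everything that holds for the Lagrange basis modulo \<open>p\<close> becomes an identity at a root of
  \<open>p\<close>: distinct basis polynomials have a product divisible by \<open>p\<close>, and they add up to \<open>1\<close>.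
\<close>
lemma lagrange_idempotents:
  fixes x :: "'a::complex_banach_algebra_1"
  assumes inj: "inj_on lam {1..n}" and "n \<ge> 1"
    and root: "alg_poly (\<Prod>i=1..n. [:- lam i, 1:]) x = 0"
  defines "f \<equiv> \<lambda>i. alg_poly (lagrange_basis lam n i) x"
  shows "i \<in> {1..n} \<Longrightarrow> f i * f i = f i"
    and "i \<in> {1..n} \<Longrightarrow> j \<in> {1..n} \<Longrightarrow> i \<noteq> j \<Longrightarrow> f i * f j = 0"
    and "(\<Sum>i=1..n. f i) = 1"
    and "i \<in> {1..n} \<Longrightarrow> x * f i = lam i *\<^sub>C f i"
proof -
  show orth: "f i * f j = 0" if "i \<in> {1..n}" "j \<in> {1..n}" "i \<noteq> j" for i j
    unfolding f_def alg_poly_mult[symmetric]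
    by (rule alg_poly_eq_0_if_dvd[OF root prod_dvd_lagrange_basis_mult[OF that]])
  show total: "(\<Sum>i=1..n. f i) = 1"
    using sum_lagrange_basis[OF inj \<open>n \<ge> 1\<close>] by (simp add: f_def alg_poly_sum[symmetric])
  show "f i * f i = f i" if "i \<in> {1..n}" for i
  proof -
    have "f i = f i * (\<Sum>j=1..n. f j)" by (simp only: total mult_1_right)
    also have "\<dots> = f i * f i"
      unfolding sum_distrib_left
      by (rule sum_eq_single[OF _ that]) (simp_all add: orth[OF that _ not_sym] del: atLeastAtMost_iff)
    finally show ?thesis by (rule sym)
  qed
  show "x * f i = lam i *\<^sub>C f i" if "i \<in> {1..n}" for i
  proof -
    have "alg_poly ([:- lam i, 1:] * lagrange_basis lam n i) x = 0"
      unfolding linear_mult_lagrange_basis[OF that] alg_poly_smult root by (simp add: scaleC.zero_right)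
    then show ?thesis
      by (simp only: alg_poly_mult alg_poly_linear f_def left_diff_distrib mult_scaleC_left mult_1_left
          right_minus_eq)
  qed
qed

section \<open>Power series with coefficients in a Banach space\<close>

lemma sums_imp_geometric_bound:
  fixes c :: "nat \<Rightarrow> 'a::complex_normed_vector"
  assumes "(\<lambda>k. w ^ k *\<^sub>C c k) sums s" "w \<noteq> 0"
  obtains C where "C > 0" "\<And>k. norm (c k) \<le> C * inverse (cmod w) ^ k"
proof -
  have "Bseq (\<lambda>k. w ^ k *\<^sub>C c k)"
    using assms(1) by (intro convergent_imp_Bseq) (auto simp: convergent_def sums_iff dest: summable_LIMSEQ_zero)
  then obtain C where "C > 0" and C: "\<And>k. norm (w ^ k *\<^sub>C c k) \<le> C"
    by (auto simp: Bseq_def)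
  have "norm (c k) \<le> C * inverse (cmod w) ^ k" for k
    using C[of k] assms(2) by (simp add: norm_scaleC norm_power power_inverse field_simps)
  with \<open>C > 0\<close> show ?thesis by (rule that)
qed

lemma geometric_bound_imp_summable_norm:
  fixes c :: "nat \<Rightarrow> 'a::complex_normed_vector"
  assumes "\<And>k. norm (c k) \<le> C * \<rho> ^ k" "\<rho> > 0" "cmod w < inverse \<rho>"
  shows "summable (\<lambda>k. norm (w ^ k *\<^sub>C c k))"
proof (rule summable_comparison_test')
  have "norm (cmod w * \<rho>) < 1"
    using assms by (simp add: field_simps)
  then show "summable (\<lambda>k. C * (cmod w * \<rho>) ^ k)"
    by (intro summable_mult summable_geometric)
  show "norm (norm (w ^ k *\<^sub>C c k)) \<le> C * (cmod w * \<rho>) ^ k" if "k \<ge> 0" for k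
  proof -
    have "cmod w ^ k * norm (c k) \<le> cmod w ^ k * (C * \<rho> ^ k)"
      by (intro mult_left_mono assms) simp
    then show ?thesis
      by (simp add: norm_scaleC norm_power power_mult_distrib mult_ac)
  qed
qed

lemma sums_imp_summable_norm_smaller:
  fixes c :: "nat \<Rightarrow> 'a::complex_normed_vector"
  assumes "\<And>w. w \<in> ball 0 r \<Longrightarrow> (\<lambda>k. w ^ k *\<^sub>C c k) sums f w" and "cmod w < r"
  shows "summable (\<lambda>k. norm (w ^ k *\<^sub>C c k))"
proof -
  define t where "t = (cmod w + r) / 2"
  have t: "cmod w < t" "0 < t" "t < r"
    using assms(2) norm_ge_zero[of w] unfolding t_def by (auto simp del: norm_ge_zero)
  have "(\<lambda>k. of_real t ^ k *\<^sub>C c k) sums f (of_real t)"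
    using t by (intro assms(1)) simp
  then obtain C where "\<And>k. norm (c k) \<le> C * inverse t ^ k"
    using t by (elim sums_imp_geometric_bound) auto
  then show ?thesis
    using t by (intro geometric_bound_imp_summable_norm[where C = C and \<rho> = "inverse t"]) auto
qed

text \<open>
  Once the coefficients below \<open>n\<close> vanish, division by \<open>w ^ n\<close> expresses \<open>- c n\<close> as
  a series with a factor \<open>w\<close>; a geometric majorant shows that it tends to \<open>0\<close> with \<open>w\<close>.
\<close>
lemma power_series_zero_coeffs:
  fixes c :: "nat \<Rightarrow> 'a::{complex_normed_vector,banach}"
  assumes "r > 0" and zero: "\<And>w. w \<in> ball 0 r \<Longrightarrow> (\<lambda>k. w ^ k *\<^sub>C c k) sums 0"
  shows "c n = 0"
proof (induction n rule: less_induct)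
  case (less n)
  define t where "t = r / 2"
  have t: "0 < t" "t < r" using \<open>r > 0\<close> by (auto simp: t_def)
  have "(\<lambda>k. of_real t ^ k *\<^sub>C c k) sums 0"
    using t by (intro zero) simp
  then obtain C where "C > 0" and C: "\<And>k. norm (c k) \<le> C * inverse t ^ k"
    using t by (elim sums_imp_geometric_bound) auto
  have bound: "norm (c n) \<le> x * (2 * C * inverse t ^ Suc n)" if x: "0 < x" "x \<le> t / 2" for x :: real
  proof -
    have "(\<lambda>k. of_real x ^ k *\<^sub>C c k) sums 0"
      using t x by (intro zero) simp
    then have "(\<lambda>k. of_real x ^ (k + n) *\<^sub>C c (k + n)) sums 0"
      by (subst sums_iff_shift) (simp add: less.IH scaleC.zero_right)
    then have "(\<lambda>k. inverse (of_real x ^ n) *\<^sub>C of_real x ^ (k + n) *\<^sub>C c (k + n)) sums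
        (inverse (of_real x ^ n) *\<^sub>C 0)"
      by (rule bounded_linear.sums[OF bounded_linear_scaleC_right])
    then have "(\<lambda>k. of_real x ^ k *\<^sub>C c (k + n)) sums 0"
      using x by (simp add: scaleC_scaleC power_add scaleC.zero_right field_simps)
    then have "(\<lambda>k. of_real x ^ Suc k *\<^sub>C c (Suc k + n)) sums (0 - c n)"
      by (subst sums_Suc_iff) simp
    moreover have geo: "(\<lambda>k. x * (C * inverse t ^ Suc n) * (x * inverse t) ^ k) sums
        (x * (C * inverse t ^ Suc n) * (1 / (1 - x * inverse t)))"
      using x t by (intro sums_mult geometric_sums) (simp add: field_simps)
    ultimately have le1: "norm (0 - c n) \<le> x * (C * inverse t ^ Suc n) * (1 / (1 - x * inverse t))"
    proof (rule norm_sums_le)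
      fix k
      have "norm (of_real x ^ Suc k *\<^sub>C c (Suc k + n)) \<le> x ^ Suc k * (C * inverse t ^ (Suc k + n))"
        using x by (simp add: norm_scaleC norm_power norm_mult C mult_left_mono del: power_Suc add_Suc)
      also have "\<dots> = x * (C * inverse t ^ Suc n) * (x * inverse t) ^ k"
        by (simp add: power_add power_mult_distrib mult_ac)
      finally show "norm (of_real x ^ Suc k *\<^sub>C c (Suc k + n)) \<le> x * (C * inverse t ^ Suc n) * (x * inverse t) ^ k" .
    qed
    have "1 / (1 - x * inverse t) \<le> 2"
      using x t by (simp add: field_simps)
    then have le2: "x * (C * inverse t ^ Suc n) * (1 / (1 - x * inverse t)) \<le> x * (C * inverse t ^ Suc n) * 2"
      using x t \<open>C > 0\<close> by (intro mult_left_mono) auto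
    have "norm (c n) \<le> x * (C * inverse t ^ Suc n) * 2"
      using le1 le2 by simp
    then show ?thesis by (simp add: mult_ac)
  qed
  show "c n = 0"
  proof (rule ccontr)
    assume "c n \<noteq> 0"
    define K where "K = 2 * C * inverse t ^ Suc n"
    have "K > 0" using \<open>C > 0\<close> t by (simp add: K_def)
    define x where "x = min (t / 2) (norm (c n) / (2 * K))"
    have "0 < x" "x \<le> t / 2"
      using \<open>K > 0\<close> t \<open>c n \<noteq> 0\<close> by (auto simp: x_def)
    then have "norm (c n) \<le> x * K" using bound by (simp add: K_def)
    also have "\<dots> \<le> norm (c n) / (2 * K) * K"
      using \<open>K > 0\<close> by (intro mult_right_mono) (auto simp: x_def)
    also have "\<dots> < norm (c n)"
      using \<open>K > 0\<close> \<open>c n \<noteq> 0\<close> by simp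
    finally show False by simp
  qed
qed

text \<open>
  Both sides are the sum of the absolutely summable double family \<open>prod (u i) (v j)\<close>, the left
  one grouped by \<open>i + j\<close>.
\<close>
lemma Cauchy_product_sums_bilinear:
  fixes prod :: "'a::banach \<Rightarrow> 'b::banach \<Rightarrow> 'c::banach"
  assumes "bounded_bilinear prod"
    and "summable (\<lambda>k. norm (u k))" "summable (\<lambda>k. norm (v k))"
    and "u sums x" "v sums y"
  shows "(\<lambda>k. \<Sum>i\<le>k. prod (u i) (v (k - i))) sums prod x y"
proof -
  interpret bounded_bilinear prod by fact
  obtain K where K: "K \<ge> 0" "\<And>a b. norm (prod a b) \<le> norm a * norm b * K"
    using nonneg_bounded by blast
  define h where "h = (\<lambda>(i, j). prod (u i) (v j))"
  have uv: "(u has_sum x) UNIV" "(v has_sum y) UNIV"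
    using assms by (auto intro!: norm_summable_imp_has_sum)
  have abs: "(\<lambda>k. norm (u k)) summable_on UNIV" "(\<lambda>k. norm (v k)) summable_on UNIV"
    using assms(2,3) by (auto intro!: norm_summable_imp_summable_on)
  have "(\<lambda>x. norm (case x of (i, j) \<Rightarrow> norm (u i) * norm (v j) * K)) summable_on UNIV \<times> UNIV"
    unfolding Infinite_Sum.abs_summable_on_Sigma_iff
  proof (intro conjI ballI)
    fix i
    show "(\<lambda>j. norm (case (i, j) of (i, j) \<Rightarrow> norm (u i) * norm (v j) * K)) summable_on UNIV"
      using K abs(2) by (simp add: summable_on_cmult_right summable_on_cmult_left)
    have "(\<Sum>\<^sub>\<infinity>j. norm (case (i, j) of (i, j) \<Rightarrow> norm (u i) * norm (v j) * K))
        = norm (u i) * ((\<Sum>\<^sub>\<infinity>j. norm (v j)) * K)" for i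
      using K abs(2) by (simp add: infsum_cmult_right infsum_cmult_left summable_on_cmult_left mult.assoc)
    then show "(\<lambda>i. norm (\<Sum>\<^sub>\<infinity>j. norm (case (i, j) of (i, j) \<Rightarrow> norm (u i) * norm (v j) * K))) summable_on UNIV"
      using abs(1) K by (simp add: abs_mult summable_on_cmult_left)
  qed
  then have "(\<lambda>x. norm (h x)) summable_on UNIV \<times> UNIV"
    by (rule Infinite_Sum.abs_summable_on_comparison_test) (use K in \<open>auto simp: h_def\<close>)
  then have "h summable_on UNIV \<times> UNIV"
    by (rule abs_summable_summable)
  then obtain s where s: "(h has_sum s) (UNIV \<times> UNIV)"
    by (auto simp: summable_on_def)
  have "((\<lambda>i. prod (u i) y) has_sum s) UNIV"
  proof (rule has_sum_SigmaD[OF s])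
    show "((\<lambda>j. h (i, j)) has_sum prod (u i) y) UNIV" for i
      unfolding h_def prod.case
      by (rule has_sum_bounded_linear[OF bounded_linear_right uv(2)])
  qed
  moreover have "((\<lambda>i. prod (u i) y) has_sum prod x y) UNIV"
    by (rule has_sum_bounded_linear[OF bounded_linear_left uv(1)])
  ultimately have "s = prod x y"
    by (rule has_sum_unique)
  have "(h has_sum s) (UNIV \<times> UNIV) \<longleftrightarrow> ((\<lambda>(k, i). h (i, k - i)) has_sum s) (SIGMA k:UNIV. {..k})"
    by (rule has_sum_reindex_bij_witness[where i = "\<lambda>(k, i). (i, k - i)" and j = "\<lambda>(i, j). (i + j, i)"]) auto
  with s have "((\<lambda>(k, i). h (i, k - i)) has_sum s) (SIGMA k:UNIV. {..k})"
    by simp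
  then have "((\<lambda>k. \<Sum>i\<le>k. h (i, k - i)) has_sum s) UNIV"
    by (rule has_sum_SigmaD) (auto intro: has_sum_finite)
  then show ?thesis
    unfolding \<open>s = prod x y\<close> h_def prod.case by (rule has_sum_imp_sums)
qed

lemma vec_analytic_on_const:
  fixes x :: "'a::complex_normed_vector"
  shows "(\<lambda>_. x) vec_analytic_on S"
proof -
  have "(\<lambda>k. (w - z) ^ k *\<^sub>C (if k = 0 then x else 0)) sums x" for w z
  proof -
    have "(\<lambda>k. (w - z) ^ k *\<^sub>C (if k = 0 then x else 0)) = (\<lambda>k. if k = 0 then x else 0)"
      by (auto simp: scaleC.zero_right)
    then show ?thesis using sums_single[of 0 "\<lambda>_. x"] by simp
  qed
  then show ?thesis
    unfolding vec_analytic_on_def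
    by (intro ballI exI[of _ "\<lambda>k. if k = 0 then x else 0"] exI[of _ 1]) simp
qed

lemma vec_analytic_on_add:
  fixes f g :: "complex \<Rightarrow> 'a::complex_normed_vector"
  assumes "f vec_analytic_on S" "g vec_analytic_on S"
  shows "(\<lambda>z. f z + g z) vec_analytic_on S"
  unfolding vec_analytic_on_def
proof
  fix z assume "z \<in> S"
  then obtain c r d t where
    f: "r > 0" "\<And>w. w \<in> ball z r \<Longrightarrow> (\<lambda>k. (w - z) ^ k *\<^sub>C c k) sums f w" and
    g: "t > 0" "\<And>w. w \<in> ball z t \<Longrightarrow> (\<lambda>k. (w - z) ^ k *\<^sub>C d k) sums g w"
    using assms unfolding vec_analytic_on_def by metis
  have "\<forall>w\<in>ball z (min r t). (\<lambda>k. (w - z) ^ k *\<^sub>C (c k + d k)) sums (f w + g w)"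
    using f(2) g(2) by (auto simp: scaleC_add_right intro!: sums_add)
  then show "\<exists>c r. r > 0 \<and> (\<forall>w\<in>ball z r. (\<lambda>k. (w - z) ^ k *\<^sub>C c k) sums (f w + g w))"
    using f(1) g(1) by (metis min_less_iff_conj)
qed

lemma vec_analytic_on_sum:
  fixes f :: "'i \<Rightarrow> complex \<Rightarrow> 'a::complex_normed_vector"
  assumes "\<And>i. i \<in> I \<Longrightarrow> f i vec_analytic_on S"
  shows "(\<lambda>z. \<Sum>i\<in>I. f i z) vec_analytic_on S"
  using assms
  by (induction I rule: infinite_finite_induct)
    (simp_all add: vec_analytic_on_const vec_analytic_on_add)

lemma vec_analytic_on_bounded_linear:
  fixes L :: "'a::complex_normed_vector \<Rightarrow> 'b::complex_normed_vector"
  assumes "bounded_linear L" "\<And>c x. L (c *\<^sub>C x) = c *\<^sub>C L x" "f vec_analytic_on S"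
  shows "(\<lambda>z. L (f z)) vec_analytic_on S"
  unfolding vec_analytic_on_def
proof
  fix z assume "z \<in> S"
  then obtain c r where
    f: "r > 0" "\<And>w. w \<in> ball z r \<Longrightarrow> (\<lambda>k. (w - z) ^ k *\<^sub>C c k) sums f w"
    using assms(3) unfolding vec_analytic_on_def by metis
  have "\<forall>w\<in>ball z r. (\<lambda>k. (w - z) ^ k *\<^sub>C L (c k)) sums L (f w)"
    using bounded_linear.sums[OF assms(1) f(2)] by (simp add: assms(2))
  then show "\<exists>c r. r > 0 \<and> (\<forall>w\<in>ball z r. (\<lambda>k. (w - z) ^ k *\<^sub>C c k) sums L (f w))"
    using f(1) by (intro exI[of _ "\<lambda>k. L (c k)"] exI[of _ r]) auto
qed

lemma vec_analytic_on_mult: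
  fixes f g :: "complex \<Rightarrow> 'a::complex_banach_algebra_1"
  assumes "f vec_analytic_on S" "g vec_analytic_on S"
  shows "(\<lambda>z. f z * g z) vec_analytic_on S"
  unfolding vec_analytic_on_def
proof
  fix z assume "z \<in> S"
  then obtain c r d t where
    f: "r > 0" "\<And>w. w \<in> ball z r \<Longrightarrow> (\<lambda>k. (w - z) ^ k *\<^sub>C c k) sums f w" and
    g: "t > 0" "\<And>w. w \<in> ball z t \<Longrightarrow> (\<lambda>k. (w - z) ^ k *\<^sub>C d k) sums g w"
    using assms unfolding vec_analytic_on_def by metis
  define m where "m = min r t"
  have f': "(\<lambda>k. w ^ k *\<^sub>C c k) sums f (z + w)" and g': "(\<lambda>k. w ^ k *\<^sub>C d k) sums g (z + w)"
    if "w \<in> ball 0 m" for w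
    using f(2)[of "z + w"] g(2)[of "z + w"] that by (auto simp: m_def dist_norm)
  have "(\<lambda>k. (w - z) ^ k *\<^sub>C (\<Sum>i\<le>k. c i * d (k - i))) sums (f w * g w)"
    if "w \<in> ball z m" for w
  proof -
    define h where "h = w - z"
    have h: "h \<in> ball 0 m" "cmod h < m" "z + h = w"
      using that by (auto simp: h_def dist_norm norm_minus_commute)
    have "(\<lambda>k. \<Sum>i\<le>k. (h ^ i *\<^sub>C c i) * (h ^ (k - i) *\<^sub>C d (k - i))) sums (f w * g w)"
      using f'[OF h(1)] g'[OF h(1)] h(3)
        sums_imp_summable_norm_smaller[OF f' h(2)] sums_imp_summable_norm_smaller[OF g' h(2)]
      by (intro Cauchy_product_sums_bilinear[OF bounded_bilinear_mult]) auto
    also have "(\<lambda>k. \<Sum>i\<le>k. (h ^ i *\<^sub>C c i) * (h ^ (k - i) *\<^sub>C d (k - i))) =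
        (\<lambda>k. h ^ k *\<^sub>C (\<Sum>i\<le>k. c i * d (k - i)))"
      by (auto simp: mult_scaleC_left mult_scaleC_right scaleC_scaleC scaleC.sum_right
          power_add[symmetric] intro!: sum.cong)
    finally show ?thesis by (simp add: h_def)
  qed
  moreover have "m > 0" using f(1) g(1) by (simp add: m_def)
  ultimately show "\<exists>c r. r > 0 \<and> (\<forall>w\<in>ball z r. (\<lambda>k. (w - z) ^ k *\<^sub>C c k) sums (f w * g w))"
    by (intro exI[of _ "\<lambda>k. \<Sum>i\<le>k. c i * d (k - i)"] exI[of _ m]) auto
qed

lemma vec_analytic_on_alg_poly:
  assumes "f vec_analytic_on S"
  shows "(\<lambda>z. alg_poly p (f z)) vec_analytic_on S"
  by (induction p)
    (simp_all add: alg_poly_pCons vec_analytic_on_const vec_analytic_on_add vec_analytic_on_mult assms)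

lemma vec_analytic_on_subset:
  "f vec_analytic_on T \<Longrightarrow> S \<subseteq> T \<Longrightarrow> f vec_analytic_on S"
  by (auto simp: vec_analytic_on_def)

text \<open>
  Expanding \<open>(z + h) ^ k\<close> binomially turns the power series at \<open>0\<close> into a double series in
  powers of \<open>h\<close>, absolutely summable since the given series converges absolutely at
  \<open>\<bar>z\<bar> + \<bar>h\<bar> < r\<close>.
\<close>
lemma power_series_imp_vec_analytic_on:
  fixes c :: "nat \<Rightarrow> 'a::{complex_normed_vector,banach}"
  assumes f: "\<And>w. w \<in> ball 0 r \<Longrightarrow> (\<lambda>k. w ^ k *\<^sub>C c k) sums f w"
  shows "f vec_analytic_on ball 0 r"
  unfolding vec_analytic_on_def
proof
  fix z :: complex assume "z \<in> ball 0 r"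
  define \<delta> where "\<delta> = (r - cmod z) / 2"
  have \<delta>: "\<delta> > 0" "cmod z + \<delta> < r"
    using \<open>z \<in> ball 0 r\<close> by (auto simp: \<delta>_def field_simps)
  define F where "F = (\<lambda>h (k, j). (of_nat (k choose j) * h ^ j * z ^ (k - j)) *\<^sub>C c k)"
  define e where "e = (\<lambda>j. \<Sum>\<^sub>\<infinity>k\<in>{j..}. (of_nat (k choose j) * z ^ (k - j)) *\<^sub>C c k)"
  have summable: "(\<lambda>x. norm (F h x)) summable_on (SIGMA k:UNIV. {..k})" if h: "cmod h \<le> \<delta>" for h
    unfolding Infinite_Sum.abs_summable_on_Sigma_iff
  proof (intro conjI ballI)
    define t where "t = cmod h + cmod z"
    have t: "cmod (of_real t) = t"
      by (simp only: t_def norm_of_real abs_of_nonneg add_nonneg_nonneg norm_ge_zero)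
    have "summable (\<lambda>k. norm (of_real t ^ k *\<^sub>C c k))"
      using \<delta> h by (intro sums_imp_summable_norm_smaller[OF f]) (simp_all only: t, simp add: t_def)
    then have "(\<lambda>k. norm (of_real t ^ k *\<^sub>C c k)) summable_on UNIV"
      by (intro norm_summable_imp_summable_on) auto
    moreover have "(\<Sum>\<^sub>\<infinity>j\<in>{..k}. norm (F h (k, j))) = norm (of_real t ^ k *\<^sub>C c k)" for k
    proof -
      have "(\<Sum>\<^sub>\<infinity>j\<in>{..k}. norm (F h (k, j))) =
          (\<Sum>j\<le>k. of_nat (k choose j) * cmod h ^ j * cmod z ^ (k - j)) * norm (c k)"
        by (simp add: F_def norm_scaleC norm_mult norm_power sum_distrib_right)
      also have "\<dots> = t ^ k * norm (c k)"
        by (simp add: t_def binomial_ring)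
      finally show ?thesis
        using t by (simp only: norm_scaleC norm_power)
    qed
    ultimately show "(\<lambda>k. norm (\<Sum>\<^sub>\<infinity>j\<in>{..k}. norm (F h (k, j)))) summable_on UNIV"
      by simp
  qed auto
  have swap: "((\<lambda>(j, k). F h (k, j)) has_sum s) (SIGMA j:UNIV. {j..})"
    if "(F h has_sum s) (SIGMA k:UNIV. {..k})" for h s
  proof -
    have "(F h has_sum s) (SIGMA k:UNIV. {..k}) \<longleftrightarrow> ((\<lambda>(j, k). F h (k, j)) has_sum s) (SIGMA j:UNIV. {j..})"
      by (rule has_sum_reindex_bij_witness[where i = "\<lambda>(j, k). (k, j)" and j = "\<lambda>(k, j). (j, k)"]) auto
    with that show ?thesis by simp
  qed
  have inner: "((\<lambda>k. F h (k, j)) has_sum h ^ j *\<^sub>C e j) {j..}" for h j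
  proof -
    have "F (of_real \<delta>) summable_on (SIGMA k:UNIV. {..k})"
      by (rule abs_summable_summable[OF summable]) (use \<delta> in simp)
    then have "F (of_real \<delta>) summable_on (\<lambda>k. (k, j)) ` {j..}"
      by (rule summable_on_subset_banach) auto
    then have "(\<lambda>k. F (of_real \<delta>) (k, j)) summable_on {j..}"
      by (subst (asm) summable_on_reindex) (auto simp: o_def inj_on_def)
    then have "(\<lambda>k. inverse (of_real \<delta> ^ j) *\<^sub>C F (of_real \<delta>) (k, j)) summable_on {j..}"
      by (rule summable_on_bounded_linear[OF bounded_linear_scaleC_right])
    then have "(\<lambda>k. (of_nat (k choose j) * z ^ (k - j)) *\<^sub>C c k) summable_on {j..}"
      using \<delta> by (simp add: F_def scaleC_scaleC field_simps)
    then have "((\<lambda>k. (of_nat (k choose j) * z ^ (k - j)) *\<^sub>C c k) has_sum e j) {j..}"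
      unfolding e_def by (rule has_sum_infsum)
    then have "((\<lambda>k. h ^ j *\<^sub>C (of_nat (k choose j) * z ^ (k - j)) *\<^sub>C c k) has_sum h ^ j *\<^sub>C e j) {j..}"
      by (rule has_sum_bounded_linear[OF bounded_linear_scaleC_right])
    then show ?thesis
      by (simp add: F_def scaleC_scaleC mult_ac)
  qed
  have "(\<lambda>j. h ^ j *\<^sub>C e j) sums f (z + h)" if h: "cmod h < \<delta>" for h
  proof -
    obtain s where s: "(F h has_sum s) (SIGMA k:UNIV. {..k})"
      using abs_summable_summable[OF summable[of h]] h by (auto simp: summable_on_def)
    have "((\<lambda>k. (z + h) ^ k *\<^sub>C c k) has_sum s) UNIV"
    proof (rule has_sum_SigmaD[OF s])
      fix k
      have "(\<Sum>j\<le>k. F h (k, j)) = (h + z) ^ k *\<^sub>C c k"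
        by (simp add: F_def binomial_ring scaleC.sum_left)
      then show "((\<lambda>j. F h (k, j)) has_sum (z + h) ^ k *\<^sub>C c k) {..k}"
        by (metis add.commute finite_atMost has_sum_finite)
    qed
    then have "(\<lambda>k. (z + h) ^ k *\<^sub>C c k) sums s"
      by (rule has_sum_imp_sums)
    moreover have "(\<lambda>k. (z + h) ^ k *\<^sub>C c k) sums f (z + h)"
      using \<delta> h norm_triangle_ineq[of z h] by (intro f) simp
    ultimately have "s = f (z + h)"
      by (rule sums_unique2)
    have "((\<lambda>j. h ^ j *\<^sub>C e j) has_sum s) UNIV"
      by (rule has_sum_SigmaD[OF swap[OF s]]) (simp add: inner)
    then show ?thesis
      unfolding \<open>s = f (z + h)\<close> by (rule has_sum_imp_sums)
  qed
  from this[of "_ - z"] have "\<forall>w\<in>ball z \<delta>. (\<lambda>k. (w - z) ^ k *\<^sub>C e k) sums f w"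
    by (auto simp: dist_norm norm_minus_commute)
  with \<delta>(1) show "\<exists>e \<delta>. \<delta> > 0 \<and> (\<forall>w\<in>ball z \<delta>. (\<lambda>k. (w - z) ^ k *\<^sub>C e k) sums f w)"
    by blast
qed

section \<open>Lifting analytic functions along a family of operators\<close>

text \<open>
  The open mapping theorem in quantitative form.  Baire's theorem provides a ball in the closure
  of some \<open>f ` cball 0 n\<close>; differences of points there approximate every \<open>y\<close> up to half
  its norm, and iterating on the remainder gives an exact preimage as a geometrically convergent
  series.
\<close>
lemma surj_bounded_linear_imp_bounded_preimages:
  fixes f :: "'a::banach \<Rightarrow> 'b::banach"
  assumes "bounded_linear f" "surj f"
  obtains K where "K > 0" "\<And>y. \<exists>x. f x = y \<and> norm x \<le> K * norm y"
proof -
  interpret bounded_linear f by fact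
  define T where "T = (\<lambda>n::nat. closure (f ` cball 0 (real n)))"
  have "\<exists>n. interior (T n) \<noteq> {}"
  proof (rule ccontr)
    assume "\<nexists>n. interior (T n) \<noteq> {}"
    then have "interior (T n) = {}" for n by blast
    then have "euclidean interior_of (\<Union>(range T)) = {}"
      by (intro Baire_category_alt disjI1 completely_metrizable_space_euclidean)
        (auto simp: T_def)
    moreover have "y \<in> \<Union>(range T)" for y
    proof -
      obtain x where "y = f x" using \<open>surj f\<close> by blast
      moreover obtain n where "norm x \<le> real n" using real_arch_simple by blast
      ultimately have "y \<in> T n"
        unfolding T_def by (intro closure_subset[THEN subsetD]) auto
      then show ?thesis by blast
    qed
    then have "\<Union>(range T) = UNIV" by blast
    ultimately show False by simp
  qed
  then obtain n y0 where "y0 \<in> interior (T n)" by blast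
  then obtain \<epsilon> where "\<epsilon> > 0" and \<epsilon>: "ball y0 \<epsilon> \<subseteq> T n"
    by (metis mem_interior)
  define N where "N = real n"
  have approx_small: "\<exists>x. norm x \<le> 2 * N \<and> norm (y - f x) < \<eta>" if "norm y < \<epsilon>" "\<eta> > 0" for y \<eta>
  proof -
    have "y0 + y \<in> T n" "y0 \<in> T n"
      using \<epsilon> \<open>\<epsilon> > 0\<close> that by (auto simp: subset_iff dist_norm)
    then obtain x1 x2 where x: "norm x1 \<le> N" "norm x2 \<le> N"
      "dist (f x1) (y0 + y) < \<eta> / 2" "dist (f x2) y0 < \<eta> / 2"
      unfolding T_def closure_approachable N_def
      using half_gt_zero[OF \<open>\<eta> > 0\<close>] by (metis (no_types, lifting) imageE mem_cball_0)
    have "norm (y - f (x1 - x2)) = norm ((y0 + y - f x1) - (y0 - f x2))"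
      by (simp add: diff algebra_simps)
    also have "\<dots> \<le> norm (y0 + y - f x1) + norm (y0 - f x2)"
      by (rule norm_triangle_ineq4)
    also have "\<dots> < \<eta>"
      using x(3,4) by (simp add: dist_norm norm_minus_commute)
    finally have "norm (y - f (x1 - x2)) < \<eta>" .
    moreover have "norm (x1 - x2) \<le> 2 * N"
      using norm_triangle_ineq4[of x1 x2] x by simp
    ultimately show ?thesis by blast
  qed
  define M where "M = 4 * N / \<epsilon>"
  have "\<exists>x. norm x \<le> M * norm y \<and> norm (y - f x) \<le> norm y / 2" for y
  proof (cases "y = 0")
    case True
    then show ?thesis by (intro exI[of _ 0]) simp
  next
    case False
    define k where "k = 2 * norm y / \<epsilon>"
    have "k > 0" using False \<open>\<epsilon> > 0\<close> by (simp add: k_def)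
    have "norm (inverse k *\<^sub>R y) < \<epsilon>"
      using False \<open>\<epsilon> > 0\<close> by (simp add: k_def)
    from approx_small[OF this, of "\<epsilon> / 4"] obtain x
      where x: "norm x \<le> 2 * N" "norm (inverse k *\<^sub>R y - f x) < \<epsilon> / 4"
      using \<open>\<epsilon> > 0\<close> by auto
    have "y - f (k *\<^sub>R x) = k *\<^sub>R (inverse k *\<^sub>R y - f x)"
      using \<open>k > 0\<close> by (simp add: scaleR scaleR_diff_right)
    then have "norm (y - f (k *\<^sub>R x)) \<le> k * (\<epsilon> / 4)"
      using x(2) \<open>k > 0\<close> by (metis abs_of_pos less_imp_le mult_left_mono norm_scaleR)
    also have "\<dots> = norm y / 2"
      using \<open>\<epsilon> > 0\<close> by (simp add: k_def)
    finally have "norm (y - f (k *\<^sub>R x)) \<le> norm y / 2" .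
    moreover have "norm (k *\<^sub>R x) \<le> k * (2 * N)"
      using x(1) \<open>k > 0\<close> by simp
    moreover have "k * (2 * N) = M * norm y"
      by (simp add: k_def M_def)
    ultimately show ?thesis by metis
  qed
  then obtain g where g: "\<And>y. norm (g y) \<le> M * norm y" "\<And>y. norm (y - f (g y)) \<le> norm y / 2"
    by metis
  have "M \<ge> 0" using \<open>\<epsilon> > 0\<close> by (simp add: M_def N_def)
  have "\<exists>x. f x = y \<and> norm x \<le> (2 * M + 1) * norm y" for y
  proof -
    define R where "R = (\<lambda>k. ((\<lambda>y. y - f (g y)) ^^ k) y)"
    have R: "R 0 = y" "\<And>k. R (Suc k) = R k - f (g (R k))"
      by (simp_all add: R_def)
    have R_le: "norm (R k) \<le> norm y * (1 / 2) ^ k" for k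
    proof (induction k)
      case (Suc k)
      have "norm (R (Suc k)) \<le> norm (R k) / 2" unfolding R by (rule g)
      with Suc show ?case by simp
    qed (simp add: R)
    have g_le: "norm (g (R k)) \<le> M * norm y * (1 / 2) ^ k" for k
      using order_trans[OF g(1) mult_left_mono[OF R_le \<open>M \<ge> 0\<close>]] by (simp add: mult.assoc)
    have geo: "(\<lambda>k. M * norm y * (1 / 2) ^ k) sums (M * norm y * 2)"
      using geometric_sums[of "1 / 2 :: real"] by (intro sums_mult) simp
    have "summable (\<lambda>k. g (R k))"
      by (rule summable_comparison_test'[OF sums_summable[OF geo]]) (rule g_le)
    then obtain x where x: "(\<lambda>k. g (R k)) sums x"
      by (auto simp: summable_def)
    have "(\<lambda>k. norm y * (1 / 2) ^ k) \<longlonglongrightarrow> norm y * 0"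
      by (intro tendsto_mult tendsto_const LIMSEQ_power_zero) simp
    then have "R \<longlonglongrightarrow> 0"
      by (intro Lim_null_comparison[OF always_eventually[rule_format, OF R_le]]) simp
    then have "(\<lambda>k. R k - R (Suc k)) sums (R 0 - 0)"
      by (rule telescope_sums')
    then have "(\<lambda>k. f (g (R k))) sums y"
      by (simp add: R)
    moreover have "(\<lambda>k. f (g (R k))) sums f x"
      by (rule sums[OF x])
    ultimately have "f x = y"
      using sums_unique2 by blast
    have "norm x \<le> M * norm y * 2"
      by (rule norm_sums_le[OF x geo g_le])
    then have "norm x \<le> (2 * M + 1) * norm y"
      using norm_ge_zero[of y] unfolding distrib_right by (simp add: mult_ac del: norm_ge_zero)
    with \<open>f x = y\<close> show ?thesis by blast
  qed
  with \<open>M \<ge> 0\<close> show ?thesis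
    by (intro that[of "2 * M + 1"]) auto
qed

text \<open>
  The recursion that the coefficients of \<open>t\<close> in \<open>P z (t z) = S z\<close> satisfy when the preimages
  under the constant term of \<open>P\<close> are chosen by \<open>g\<close>.
\<close>
fun lift_coeff :: "('b::real_normed_vector \<Rightarrow> 'a::real_normed_vector) \<Rightarrow>
    (nat \<Rightarrow> 'a \<Rightarrow>\<^sub>L 'b) \<Rightarrow> (nat \<Rightarrow> 'b) \<Rightarrow> 'a \<Rightarrow> nat \<Rightarrow> 'a"
  where
    "lift_coeff g p s t0 0 = t0"
  | "lift_coeff g p s t0 (Suc n) =
      g (s (Suc n) - (\<Sum>k\<le>n. p (Suc k) (lift_coeff g p s t0 (n - k))))"

text \<open>
  The rate \<open>(2 + 3 * K * C) * \<rho>\<close> is at least \<open>2 * \<rho>\<close>, so that the sum in the recursion is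
  dominated by a geometric series of ratio \<open>1/2\<close>, and at least \<open>3 * K * C * \<rho>\<close>, which
  absorbs the constants.
\<close>
lemma norm_lift_coeff_le:
  assumes g: "\<And>y. norm (g y) \<le> K * norm y"
    and p: "\<And>k. norm (p k) \<le> C * \<rho> ^ k" and s: "\<And>k. norm (s k) \<le> C * \<rho> ^ k"
    and pos: "K > 0" "C > 0" "\<rho> > 0"
  shows "norm (lift_coeff g p s t0 n) \<le> (norm t0 + 1) * ((2 + 3 * K * C) * \<rho>) ^ n"
proof (induction n rule: less_induct)
  case (less n)
  define D where "D = norm t0 + 1"
  define \<sigma> where "\<sigma> = (2 + 3 * K * C) * \<rho>"
  have D: "D \<ge> 1" by (simp add: D_def)
  have \<sigma>: "\<sigma> > 0" "2 * \<rho> \<le> \<sigma>" "3 * K * C * \<rho> \<le> \<sigma>"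
    using pos by (simp_all add: \<sigma>_def distrib_right add_pos_pos)
  show ?case
  proof (cases n)
    case (Suc m)
    let ?t = "lift_coeff g p s t0"
    have half: "\<rho> ^ k * \<sigma> ^ (m - k) \<le> \<sigma> ^ m * (1 / 2) ^ k" if "k \<le> m" for k
    proof -
      have "\<rho> ^ k \<le> (\<sigma> / 2) ^ k"
        using \<sigma> pos by (intro power_mono) auto
      then have "\<rho> ^ k * \<sigma> ^ (m - k) \<le> (\<sigma> / 2) ^ k * \<sigma> ^ (m - k)"
        using \<sigma> by (intro mult_right_mono) auto
      also have "\<dots> = \<sigma> ^ (k + (m - k)) * (1 / 2) ^ k"
        by (simp add: power_add power_divide)
      finally show ?thesis using that by simp
    qed
    have term_le: "norm (p (Suc k) (?t (m - k))) \<le> C * \<rho> * D * \<sigma> ^ m * (1 / 2) ^ k" if "k \<le> m" for k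
    proof -
      have "norm (p (Suc k) (?t (m - k))) \<le> norm (p (Suc k)) * norm (?t (m - k))"
        by (rule norm_blinfun)
      also have "\<dots> \<le> (C * \<rho> ^ Suc k) * (D * \<sigma> ^ (m - k))"
        using less.IH[of "m - k"] Suc p[of "Suc k"] pos
        by (intro mult_mono) (auto simp: D_def \<sigma>_def)
      also have "\<dots> = C * \<rho> * D * (\<rho> ^ k * \<sigma> ^ (m - k))"
        by simp
      also have "\<dots> \<le> C * \<rho> * D * (\<sigma> ^ m * (1 / 2) ^ k)"
        using half[OF that] pos D by (intro mult_left_mono) auto
      finally show ?thesis by (simp add: mult.assoc)
    qed
    have "norm (\<Sum>k\<le>m. p (Suc k) (?t (m - k))) \<le> (\<Sum>k\<le>m. C * \<rho> * D * \<sigma> ^ m * (1 / 2) ^ k)"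
      using term_le by (intro sum_norm_le) auto
    also have "\<dots> = C * \<rho> * D * \<sigma> ^ m * (\<Sum>k\<le>m. (1 / 2) ^ k)"
      by (simp add: sum_distrib_left)
    also have "\<dots> \<le> C * \<rho> * D * \<sigma> ^ m * 2"
    proof (rule mult_left_mono)
      have "(\<Sum>k\<le>m. (1 / 2 :: real) ^ k) \<le> (\<Sum>k. (1 / 2) ^ k)"
        by (intro sum_le_suminf) auto
      also have "\<dots> = 2" by (simp add: suminf_geometric)
      finally show "(\<Sum>k\<le>m. (1 / 2 :: real) ^ k) \<le> 2" .
    qed (use pos D \<sigma> in auto)
    finally have 1: "norm (\<Sum>k\<le>m. p (Suc k) (?t (m - k))) \<le> C * \<rho> * D * \<sigma> ^ m * 2" .
    have "\<rho> ^ m \<le> D * \<sigma> ^ m"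
    proof -
      have "\<rho> ^ m \<le> \<sigma> ^ m" using \<sigma> pos by (intro power_mono) auto
      also have "\<dots> \<le> D * \<sigma> ^ m" using D \<sigma> by simp
      finally show ?thesis .
    qed
    then have "C * \<rho> * \<rho> ^ m \<le> C * \<rho> * (D * \<sigma> ^ m)"
      using pos by (intro mult_left_mono) auto
    with s[of "Suc m"] have 2: "norm (s (Suc m)) \<le> C * \<rho> * D * \<sigma> ^ m"
      by (simp add: mult.assoc)
    have "norm (?t n) \<le> K * norm (s (Suc m) - (\<Sum>k\<le>m. p (Suc k) (?t (m - k))))"
      unfolding Suc lift_coeff.simps by (rule g)
    also have "\<dots> \<le> K * (3 * (C * \<rho> * D * \<sigma> ^ m))"
      using 1 2 pos norm_triangle_ineq4[of "s (Suc m)" "\<Sum>k\<le>m. p (Suc k) (?t (m - k))"]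
      by (intro mult_left_mono) auto
    also have "\<dots> = 3 * K * C * \<rho> * (D * \<sigma> ^ m)" by simp
    also have "\<dots> \<le> \<sigma> * (D * \<sigma> ^ m)"
      using \<sigma> D by (intro mult_right_mono) auto
    also have "\<dots> = D * \<sigma> ^ n" by (simp add: Suc)
    finally show ?thesis by (simp add: D_def \<sigma>_def)
  qed simp
qed

text \<open>
  Comparing coefficients turns the equation \<open>P z (t z) = S z\<close> into a recursion that can be solved
  because \<open>P 0\<close> is onto; bounded preimages keep the growth of the solution geometric.
  Complex homogeneity, which \<open>\<Rightarrow>\<^sub>L\<close> does not include, passes from the values of \<open>P\<close> to
  its coefficients.
\<close>
lemma vec_analytic_lift:
  fixes P :: "complex \<Rightarrow> 'a::{complex_normed_vector,banach} \<Rightarrow>\<^sub>L 'b::{complex_normed_vector,banach}"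
  assumes P: "P vec_analytic_on {0}" and S: "S vec_analytic_on {0}"
    and U: "open U" "0 \<in> U"
    and hom: "\<And>z c x. z \<in> U \<Longrightarrow> P z (c *\<^sub>C x) = c *\<^sub>C P z x"
    and "surj (blinfun_apply (P 0))" and t0: "P 0 t0 = S 0"
  obtains r t where "r > 0" "t vec_analytic_on ball 0 r" "t 0 = t0"
    "\<And>z. z \<in> ball 0 r \<Longrightarrow> P z (t z) = S z"
proof -
  obtain p r1 where "r1 > 0" and p1: "\<And>w. w \<in> ball 0 r1 \<Longrightarrow> (\<lambda>k. w ^ k *\<^sub>C p k) sums P w"
    using P unfolding vec_analytic_on_def by (metis diff_zero singletonI)
  obtain s r2 where "r2 > 0" and s1: "\<And>w. w \<in> ball 0 r2 \<Longrightarrow> (\<lambda>k. w ^ k *\<^sub>C s k) sums S w"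
    using S unfolding vec_analytic_on_def by (metis diff_zero singletonI)
  obtain r3 where "r3 > 0" and r3: "ball 0 r3 \<subseteq> U"
    using U by (meson open_contains_ball)
  define m where "m = min r1 (min r2 r3)"
  have m: "m > 0" using \<open>r1 > 0\<close> \<open>r2 > 0\<close> \<open>r3 > 0\<close> by (simp add: m_def)
  have ps: "(\<lambda>k. w ^ k *\<^sub>C p k) sums P w" and ss: "(\<lambda>k. w ^ k *\<^sub>C s k) sums S w"
    and wU: "w \<in> U" if "w \<in> ball 0 m" for w
    using that p1 s1 r3 by (auto simp: m_def)
  have const_term: "(\<lambda>k. 0 ^ k *\<^sub>C c k) sums c 0" for c :: "nat \<Rightarrow> 'c::complex_normed_vector"
  proof -
    have "(\<lambda>k. 0 ^ k *\<^sub>C c k) = (\<lambda>k. if k = 0 then c k else 0)"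
      by (rule ext) (simp add: scaleC.zero_left power_0_left)
    then show ?thesis using sums_single[of 0 c] by simp
  qed
  have p0: "p 0 = P 0" and s0: "s 0 = S 0"
    using sums_unique2[OF const_term ps[of 0]] sums_unique2[OF const_term ss[of 0]] m by auto
  have p_hom: "p k (c *\<^sub>C x) = c *\<^sub>C p k x" for k c x
  proof -
    have "(\<lambda>k. w ^ k *\<^sub>C (p k (c *\<^sub>C x) - c *\<^sub>C p k x)) sums 0" if w: "w \<in> ball 0 m" for w
    proof -
      have app: "(\<lambda>k. w ^ k *\<^sub>C p k y) sums P w y" for y
        using bounded_linear.sums[OF blinfun.bounded_linear_left ps[OF w], of y]
        by (simp add: scaleC_blinfun.rep_eq)
      have "(\<lambda>k. w ^ k *\<^sub>C p k (c *\<^sub>C x) - c *\<^sub>C w ^ k *\<^sub>C p k x) sums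
          (P w (c *\<^sub>C x) - c *\<^sub>C P w x)"
        by (intro sums_diff app bounded_linear.sums[OF bounded_linear_scaleC_right])
      then show ?thesis
        by (simp add: hom[OF wU[OF w]] scaleC.diff_right scaleC_scaleC mult.commute)
    qed
    from power_series_zero_coeffs[OF m this, of k] show ?thesis by simp
  qed
  define \<rho> where "\<rho> = inverse (m / 2)"
  have "\<rho> > 0" using m by (simp add: \<rho>_def)
  have half: "of_real (m / 2) \<in> ball (0::complex) m" "of_real (m / 2) \<noteq> (0::complex)"
    "cmod (of_real (m / 2)) = m / 2"
    using m by auto
  obtain C1 where C1: "C1 > 0" "\<And>k. norm (p k) \<le> C1 * \<rho> ^ k"
    using sums_imp_geometric_bound[OF ps[OF half(1)] half(2)] unfolding half(3) \<rho>_def by blast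
  obtain C2 where C2: "C2 > 0" "\<And>k. norm (s k) \<le> C2 * \<rho> ^ k"
    using sums_imp_geometric_bound[OF ss[OF half(1)] half(2)] unfolding half(3) \<rho>_def by blast
  define C where "C = max C1 C2"
  have C: "C > 0" "\<And>k. norm (p k) \<le> C * \<rho> ^ k" "\<And>k. norm (s k) \<le> C * \<rho> ^ k"
    using C1 C2 \<open>\<rho> > 0\<close>
    by (auto simp: C_def intro: order_trans[OF _ mult_right_mono[of C1 "max C1 C2"]]
        order_trans[OF _ mult_right_mono[of C2 "max C1 C2"]])
  obtain K where "K > 0" and K: "\<And>y. \<exists>x. P 0 x = y \<and> norm x \<le> K * norm y"
    using surj_bounded_linear_imp_bounded_preimages[OF blinfun.bounded_linear_right \<open>surj (P 0)\<close>]
    by blast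
  obtain g where g: "\<And>y. P 0 (g y) = y" "\<And>y. norm (g y) \<le> K * norm y"
    using K by metis
  define t where "t = lift_coeff g p s t0"
  define \<sigma> where "\<sigma> = (2 + 3 * K * C) * \<rho>"
  have "\<sigma> > 0" using \<open>K > 0\<close> \<open>C > 0\<close> \<open>\<rho> > 0\<close> by (simp add: \<sigma>_def add_pos_pos)
  have t_le: "norm (t k) \<le> (norm t0 + 1) * \<sigma> ^ k" for k
    unfolding t_def \<sigma>_def using norm_lift_coeff_le[OF g(2) C(2,3) \<open>K > 0\<close> C(1) \<open>\<rho> > 0\<close>] .
  have conv: "(\<Sum>i\<le>k. p i (t (k - i))) = s k" for k
  proof (cases k)
    case 0
    then show ?thesis by (simp add: t_def p0 s0 t0)
  next
    case (Suc n)
    have "(\<Sum>i\<le>Suc n. p i (t (Suc n - i))) = p 0 (t (Suc n)) + (\<Sum>i\<le>n. p (Suc i) (t (n - i)))"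
      by (simp add: sum.atMost_Suc_shift del: sum.atMost_Suc)
    also have "\<dots> = s (Suc n)"
      by (simp add: p0 t_def g(1))
    finally show ?thesis by (simp add: Suc)
  qed
  define T where "T = (\<lambda>w. \<Sum>k. w ^ k *\<^sub>C t k)"
  have t_norm: "summable (\<lambda>k. norm (w ^ k *\<^sub>C t k))" if "w \<in> ball 0 (inverse \<sigma>)" for w
    using that by (intro geometric_bound_imp_summable_norm[OF t_le \<open>\<sigma> > 0\<close>]) simp
  have ts: "(\<lambda>k. w ^ k *\<^sub>C t k) sums T w" if "w \<in> ball 0 (inverse \<sigma>)" for w
    unfolding T_def using summable_norm_cancel[OF t_norm[OF that]] by (rule summable_sums)
  show ?thesis
  proof (rule that)
    let ?r = "min m (inverse \<sigma>)"
    show "?r > 0" using m \<open>\<sigma> > 0\<close> by simp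
    show "T vec_analytic_on ball 0 ?r"
      by (rule power_series_imp_vec_analytic_on[OF ts]) simp
    show "T 0 = t0"
      using sums_unique2[OF const_term ts[of 0]] \<open>\<sigma> > 0\<close> by (simp add: t_def)
    fix w :: complex assume w: "w \<in> ball 0 ?r"
    have "(\<lambda>k. \<Sum>i\<le>k. (w ^ i *\<^sub>C p i) (w ^ (k - i) *\<^sub>C t (k - i))) sums (P w) (T w)"
      using w by (intro Cauchy_product_sums_bilinear[OF bounded_bilinear_blinfun_apply] t_norm ts ps
          sums_imp_summable_norm_smaller[OF ps]) auto
    also have "(\<lambda>k. \<Sum>i\<le>k. (w ^ i *\<^sub>C p i) (w ^ (k - i) *\<^sub>C t (k - i))) = (\<lambda>k. w ^ k *\<^sub>C s k)"
    proof
      fix k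
      have "(\<Sum>i\<le>k. (w ^ i *\<^sub>C p i) (w ^ (k - i) *\<^sub>C t (k - i))) = (\<Sum>i\<le>k. w ^ k *\<^sub>C p i (t (k - i)))"
        by (rule sum.cong) (auto simp: scaleC_blinfun.rep_eq p_hom scaleC_scaleC power_add[symmetric])
      then show "(\<Sum>i\<le>k. (w ^ i *\<^sub>C p i) (w ^ (k - i) *\<^sub>C t (k - i))) = w ^ k *\<^sub>C s k"
        by (simp add: conv scaleC.sum_right[symmetric])
    qed
    finally show "P w (T w) = S w"
      using ss[of w] w sums_unique2 by auto
  qed
qed

section \<open>Idempotents modulo elements with small spectrum\<close>

lemma one_diff_power_factor:
  fixes y :: "'a::ring_1"
  shows "(\<Sum>k<n. y ^ k) * (1 - y) = 1 - y ^ n" "(1 - y) * (\<Sum>k<n. y ^ k) = 1 - y ^ n"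
proof (induction n)
  case (Suc n)
  {
    case 1
    have "(\<Sum>k<Suc n. y ^ k) * (1 - y) = (1 - y ^ n) + y ^ n * (1 - y)"
      by (simp only: sum.lessThan_Suc distrib_right Suc.IH)
    then show ?case by (simp add: right_diff_distrib power_commutes)
  next
    case 2
    have "(1 - y) * (\<Sum>k<Suc n. y ^ k) = (1 - y ^ n) + (1 - y) * y ^ n"
      by (simp only: sum.lessThan_Suc distrib_left Suc.IH)
    then show ?case by (simp add: left_diff_distrib)
  }
qed simp_all

lemma sum_powers_root_of_unity:
  fixes \<omega> :: complex
  assumes "n \<ge> 1" "\<omega> = exp (2 * of_real pi * \<i> / of_nat n)" "k < n"
  shows "(\<Sum>j<n. (\<omega> ^ j) ^ k) = (if k = 0 then of_nat n else 0)"
proof (cases "k = 0")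
  case False
  have pow: "\<omega> ^ m = exp (2 * of_real pi * \<i> * of_nat m / of_nat n)" for m
    by (simp add: assms(2) exp_of_nat_mult[symmetric] mult_ac)
  have "\<omega> ^ k \<noteq> 1"
    unfolding pow using complex_root_unity_eq_1[OF \<open>n \<ge> 1\<close>, of k] False \<open>k < n\<close> by (simp add: nat_dvd_not_less)
  moreover have "\<omega> ^ n = 1"
    unfolding pow using complex_root_unity_eq_1[OF \<open>n \<ge> 1\<close>, of n] by simp
  then have "(\<omega> ^ k) ^ n = 1"
    by (metis power_mult mult.commute power_one)
  ultimately have "(\<Sum>j<n. (\<omega> ^ k) ^ j) = 0"
    by (simp add: sum_gp_strict)
  moreover have "(\<omega> ^ k) ^ j = (\<omega> ^ j) ^ k" for j
    by (simp add: power_mult[symmetric] mult.commute)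
  ultimately show ?thesis using False by simp
qed simp

text \<open>
  The quotient of \<open>1 - z\<^sup>n x\<^sup>n\<close> by \<open>1 - z \<omega>\<^sup>j x\<close> is a finite geometric series;
  averaging these over the \<open>n\<close>-th roots of unity kills all powers except the zeroth.
\<close>
lemma resolvent_average:
  fixes x :: "'a::complex_banach_algebra_1"
  assumes "n \<ge> 1" and \<omega>: "\<omega> = exp (2 * of_real pi * \<i> / of_nat n)"
    and R: "\<And>j. (1 - (z * \<omega> ^ j) *\<^sub>C x) * R (z * \<omega> ^ j) = 1"
      "\<And>j. R (z * \<omega> ^ j) * (1 - (z * \<omega> ^ j) *\<^sub>C x) = 1"
  defines "A \<equiv> (1 / real n) *\<^sub>R (\<Sum>j<n. R (z * \<omega> ^ j))"
  shows "(1 - z ^ n *\<^sub>C x ^ n) * A = 1" "A * (1 - z ^ n *\<^sub>C x ^ n) = 1"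
proof -
  have "\<omega> ^ n = 1"
    using \<open>n \<ge> 1\<close> by (simp add: \<omega> exp_of_nat_mult[symmetric])
  then have pow: "((z * \<omega> ^ j) *\<^sub>C x) ^ n = z ^ n *\<^sub>C x ^ n" for j
    by (simp add: power_scaleC power_mult_distrib) (metis mult.right_neutral power_commuting_commutes power_mult power_one mult.commute)
  let ?G = "\<lambda>j. \<Sum>k<n. ((z * \<omega> ^ j) *\<^sub>C x) ^ k"
  have left: "(1 - z ^ n *\<^sub>C x ^ n) * R (z * \<omega> ^ j) = ?G j" for j
    using one_diff_power_factor(1)[of "(z * \<omega> ^ j) *\<^sub>C x" n] R(1)[of j]
    by (metis pow mult.assoc mult.right_neutral)
  have right: "R (z * \<omega> ^ j) * (1 - z ^ n *\<^sub>C x ^ n) = ?G j" for j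
    using one_diff_power_factor(2)[where y = "(z * \<omega> ^ j) *\<^sub>C x" and n = n] R(2)[of j]
    by (metis pow mult.assoc mult.left_neutral)
  have "(\<Sum>j<n. ?G j) = (\<Sum>k<n. \<Sum>j<n. ((z * \<omega> ^ j) *\<^sub>C x) ^ k)"
    by (rule sum.swap)
  also have "\<dots> = (\<Sum>k<n. (z ^ k * (\<Sum>j<n. (\<omega> ^ j) ^ k)) *\<^sub>C x ^ k)"
    by (simp add: power_scaleC power_mult_distrib sum_distrib_left scaleC.sum_left)
  also have "\<dots> = (z ^ 0 * (\<Sum>j<n. (\<omega> ^ j) ^ 0)) *\<^sub>C x ^ 0"
    using \<open>n \<ge> 1\<close> by (intro sum_eq_single)
      (auto simp: sum_powers_root_of_unity[OF \<open>n \<ge> 1\<close> \<omega>] scaleC.zero_left simp del: power_mult power_0_left)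
  also have "\<dots> = real n *\<^sub>R 1"
    by (simp flip: scaleC_of_real)
  finally have total: "(\<Sum>j<n. ?G j) = real n *\<^sub>R 1" .
  show "(1 - z ^ n *\<^sub>C x ^ n) * A = 1"
    using \<open>n \<ge> 1\<close> by (simp only: A_def mult_scaleR_right sum_distrib_left left total) simp
  show "A * (1 - z ^ n *\<^sub>C x ^ n) = 1"
    using \<open>n \<ge> 1\<close> by (simp only: A_def mult_scaleR_left sum_distrib_right right total) simp
qed

text \<open>
  An inverse is locally bounded, because \<open>R z - R w = (z - w) R z x R w\<close> lets its value at one
  point control nearby values; the same identity then gives continuity.
\<close>
lemma continuous_on_resolvent:
  fixes x :: "'a::complex_banach_algebra_1"
  assumes R: "\<And>z. z \<in> S \<Longrightarrow> (1 - z *\<^sub>C x) * R z = 1" "\<And>z. z \<in> S \<Longrightarrow> R z * (1 - z *\<^sub>C x) = 1"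
  shows "continuous_on S R"
  unfolding continuous_on_def
proof
  fix w assume w: "w \<in> S"
  have diff: "norm (R z - R w) \<le> cmod (z - w) * (norm (R z) * norm x * norm (R w))" if z: "z \<in> S" for z
  proof -
    have "R z * ((z - w) *\<^sub>C x) * R w = R z * ((1 - w *\<^sub>C x) - (1 - z *\<^sub>C x)) * R w"
      by (simp add: scaleC.diff_left)
    also have "\<dots> = R z * ((1 - w *\<^sub>C x) * R w) - (R z * (1 - z *\<^sub>C x)) * R w"
      by (simp only: right_diff_distrib left_diff_distrib mult.assoc)
    also have "\<dots> = R z - R w"
      by (simp only: R(1)[OF w] R(2)[OF z] mult_1_left mult_1_right)
    finally have "norm (R z - R w) = norm (R z * ((z - w) *\<^sub>C x) * R w)" by simp
    also have "\<dots> \<le> norm (R z) * norm ((z - w) *\<^sub>C x) * norm (R w)"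
      by (intro order_trans[OF norm_mult_ineq] mult_right_mono norm_mult_ineq) simp
    finally show ?thesis by (simp add: norm_scaleC mult_ac)
  qed
  define L where "L = norm x * norm (R w) + 1"
  have "L > 0" "norm x * norm (R w) \<le> L" by (auto simp: L_def add_nonneg_pos)
  have bound: "norm (R z - R w) \<le> cmod (z - w) * (2 * norm (R w) * L)"
    if z: "z \<in> S" "cmod (z - w) < 1 / (2 * L)" for z
  proof -
    have "cmod (z - w) * L \<le> 1 / 2"
      using z(2) \<open>L > 0\<close> by (simp add: field_simps)
    have le: "norm (R z - R w) \<le> cmod (z - w) * (norm (R z) * L)"
    proof -
      have "norm (R z) * (norm x * norm (R w)) \<le> norm (R z) * L"
        using \<open>norm x * norm (R w) \<le> L\<close> by (intro mult_left_mono) auto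
      then have "cmod (z - w) * (norm (R z) * norm x * norm (R w)) \<le> cmod (z - w) * (norm (R z) * L)"
        by (intro mult_left_mono) (auto simp: mult.assoc)
      with diff[OF z(1)] show ?thesis by linarith
    qed
    also have "\<dots> = cmod (z - w) * L * norm (R z)" by simp
    also have "\<dots> \<le> 1 / 2 * norm (R z)"
      using \<open>cmod (z - w) * L \<le> 1 / 2\<close> by (intro mult_right_mono) auto
    finally have "norm (R z) \<le> 2 * norm (R w)"
      using norm_triangle_ineq2[of "R z" "R w"] by simp
    then have "norm (R z) * L \<le> 2 * norm (R w) * L"
      using \<open>L > 0\<close> by (intro mult_right_mono) auto
    then have "cmod (z - w) * (norm (R z) * L) \<le> cmod (z - w) * (2 * norm (R w) * L)"
      by (intro mult_left_mono) auto
    with le show ?thesis by linarith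
  qed
  show "(R \<longlongrightarrow> R w) (at w within S)"
  proof (rule LIM_zero_cancel, rule Lim_null_comparison)
    show "\<forall>\<^sub>F z in at w within S. norm (R z - R w) \<le> cmod (z - w) * (2 * norm (R w) * L)"
      unfolding eventually_at using \<open>L > 0\<close> bound
      by (intro exI[of _ "1 / (2 * L)"]) (auto simp: dist_norm)
    have "((\<lambda>z. cmod (z - w) * (2 * norm (R w) * L)) \<longlongrightarrow> cmod (w - w) * (2 * norm (R w) * L)) (at w within S)"
      by (intro tendsto_intros)
    then show "((\<lambda>z. cmod (z - w) * (2 * norm (R w) * L)) \<longlongrightarrow> 0) (at w within S)"
      by simp
  qed
qed

text \<open>
  The averages \<open>A n z\<close> of the resolvent \<open>(1 - z x)\<^sup>-\<^sup>1\<close> over the rotations of \<open>z\<close> by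
  the \<open>n\<close>-th roots of unity are the inverses of \<open>1 - z\<^sup>n x\<^sup>n\<close>.  They are equicontinuous
  in \<open>z\<close>, uniformly in \<open>n\<close>, as the resolvent is uniformly continuous on the closed disc.
  Hence, if \<open>r\<^sup>n x\<^sup>n\<close> tends to \<open>0\<close>, then \<open>A n r'\<close> is eventually close to \<open>1\<close>
  and \<open>r'\<^sup>n x\<^sup>n\<close> bounded for every \<open>r' \<le> 1\<close> within a fixed distance of \<open>r\<close>; finitely
  many such steps lead from \<open>0\<close> to \<open>1\<close>.
\<close>
lemma spectrum_in_unit_ball_imp_power_bounded:
  fixes x :: "'a::complex_banach_algebra_1"
  assumes "spectrum x \<subseteq> ball 0 1"
  obtains C where "\<And>k. norm (x ^ k) \<le> C"
proof -
  have "\<exists>y. (1 - z *\<^sub>C x) * y = 1 \<and> y * (1 - z *\<^sub>C x) = 1" if z: "z \<in> cball 0 1" for z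
  proof (cases "z = 0")
    case False
    have "cmod (inverse z) \<ge> 1"
      using z False by (simp add: norm_inverse one_le_inverse)
    then have "inverse z \<notin> spectrum x" using assms by auto
    then obtain y where y: "(inverse z *\<^sub>C 1 - x) * y = 1" "y * (inverse z *\<^sub>C 1 - x) = 1"
      by (auto simp: spectrum_def)
    have fac: "1 - z *\<^sub>C x = z *\<^sub>C (inverse z *\<^sub>C 1 - x)"
      using False by (simp add: scaleC.diff_right scaleC_scaleC)
    have "(1 - z *\<^sub>C x) * inverse z *\<^sub>C y = 1 \<and> inverse z *\<^sub>C y * (1 - z *\<^sub>C x) = 1"
      unfolding fac using y False by (simp add: mult_scaleC_left mult_scaleC_right scaleC_scaleC)
    then show ?thesis by blast
  qed (auto simp: scaleC.zero_left)
  then obtain R where R: "\<And>z. z \<in> cball 0 1 \<Longrightarrow> (1 - z *\<^sub>C x) * R z = 1"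
    "\<And>z. z \<in> cball 0 1 \<Longrightarrow> R z * (1 - z *\<^sub>C x) = 1"
    by metis
  have "continuous_on (cball 0 1) R"
    by (rule continuous_on_resolvent[OF R])
  then have "uniformly_continuous_on (cball 0 1) R"
    by (intro compact_uniformly_continuous) auto
  then obtain \<delta> where "\<delta> > 0" and \<delta>: "\<And>z w. z \<in> cball 0 1 \<Longrightarrow> w \<in> cball 0 1 \<Longrightarrow> dist w z < \<delta> \<Longrightarrow>
      dist (R w) (R z) < 1 / 4"
    unfolding uniformly_continuous_on_def by (metis zero_less_divide_1_iff zero_less_numeral)
  have step: "\<forall>\<^sub>F n in sequentially. r' ^ n * norm (x ^ n) \<le> 1"
    if r: "0 \<le> r" "r \<le> r'" "r' \<le> 1" "r' - r < \<delta>"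
      and lim: "(\<lambda>n. r ^ n * norm (x ^ n)) \<longlonglongrightarrow> 0" for r r' :: real
  proof -
    have "\<forall>\<^sub>F n in sequentially. r ^ n * norm (x ^ n) < 1 / 8"
      using lim by (rule order_tendstoD) simp
    then show ?thesis
      using eventually_ge_at_top[of 1]
    proof eventually_elim
      case (elim n)
      define \<omega> where "\<omega> = exp (2 * of_real pi * \<i> / of_nat n)"
      define A where "A = (\<lambda>z. (1 / real n) *\<^sub>R (\<Sum>j<n. R (z * \<omega> ^ j)))"
      have \<omega>1: "cmod (\<omega> ^ j) = 1" for j
        by (simp add: \<omega>_def norm_power)
      have ball: "of_real s * \<omega> ^ j \<in> cball 0 1" if "0 \<le> s" "s \<le> 1" for s j
        using that by (simp add: norm_mult \<omega>1)
      have A: "(1 - of_real s ^ n *\<^sub>C x ^ n) * A (of_real s) = 1"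
        "A (of_real s) * (1 - of_real s ^ n *\<^sub>C x ^ n) = 1" if "0 \<le> s" "s \<le> 1" for s
        unfolding A_def using resolvent_average[OF elim(2) \<omega>_def R(1)[OF ball[OF that]] R(2)[OF ball[OF that]]] by auto
      have norm_pow: "norm (of_real s ^ n *\<^sub>C x ^ n) = s ^ n * norm (x ^ n)" if "0 \<le> s" for s
        using that by (simp add: norm_scaleC norm_power)
      \<comment> \<open>\<open>A r\<close> is close to \<open>1\<close> since it inverts \<open>1 - y\<close> with small \<open>y\<close>, and
        \<open>A r'\<close> is close to \<open>A r\<close> by the choice of \<open>\<delta>\<close>.\<close>
      have near_r: "norm (A (of_real r) - 1) \<le> 1 / 4"
      proof -
        define y where "y = of_real r ^ n *\<^sub>C x ^ n"
        have y: "norm y < 1 / 8" using elim(1) norm_pow r by (simp add: y_def)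
        have eq: "A (of_real r) - 1 = y * A (of_real r)"
          using A(1)[of r] r by (simp add: y_def left_diff_distrib algebra_simps)
        have le: "norm (A (of_real r) - 1) \<le> 1 / 8 * norm (A (of_real r))"
          unfolding eq using y by (intro order_trans[OF norm_mult_ineq] mult_right_mono) auto
        have "norm (A (of_real r)) \<le> norm (A (of_real r) - 1) + 1"
          using norm_triangle_ineq[of "A (of_real r) - 1" 1] by simp
        with le show ?thesis by linarith
      qed
      have near: "norm (A (of_real r') - A (of_real r)) \<le> 1 / 4"
      proof -
        have "A (of_real r') - A (of_real r) =
            (1 / real n) *\<^sub>R (\<Sum>j<n. R (of_real r' * \<omega> ^ j) - R (of_real r * \<omega> ^ j))"
          by (simp add: A_def scaleR_diff_right sum_subtractf)
        moreover have "norm (\<Sum>j<n. R (of_real r' * \<omega> ^ j) - R (of_real r * \<omega> ^ j)) \<le> (\<Sum>j<n. 1 / 4)"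
        proof (rule sum_norm_le)
          fix j
          have "dist (of_real r' * \<omega> ^ j) (of_real r * \<omega> ^ j) = cmod (of_real (r' - r)) * cmod (\<omega> ^ j)"
            by (simp add: dist_norm norm_mult[symmetric] left_diff_distrib)
          then have "dist (of_real r' * \<omega> ^ j) (of_real r * \<omega> ^ j) < \<delta>"
            using r by (simp only: \<omega>1 norm_of_real) simp
          then have "dist (R (of_real r' * \<omega> ^ j)) (R (of_real r * \<omega> ^ j)) < 1 / 4"
            using r by (intro \<delta> ball) auto
          then show "norm (R (of_real r' * \<omega> ^ j) - R (of_real r * \<omega> ^ j)) \<le> 1 / 4"
            by (simp add: dist_norm)
        qed
        ultimately show ?thesis
          using elim(2) by (simp add: field_simps)
      qed
      define y where "y = of_real r' ^ n *\<^sub>C x ^ n"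
      define B where "B = A (of_real r')"
      have B: "(1 - y) * B = 1" "B * (1 - y) = 1"
        using A[of r'] r by (simp_all add: y_def B_def)
      have "norm (B - 1) \<le> 1 / 2"
        using near_r near norm_triangle_ineq[of "B - A (of_real r)" "A (of_real r) - 1"]
        by (simp add: B_def)
      have "y * B = B - 1"
        using B(1) by (simp add: left_diff_distrib algebra_simps)
      then have "y = (B - 1) * (1 - y)"
        by (metis B(2) mult.assoc mult.right_neutral)
      then have "norm y \<le> norm (B - 1) * norm (1 - y)"
        by (metis norm_mult_ineq)
      also have "\<dots> \<le> 1 / 2 * (1 + norm y)"
        using \<open>norm (B - 1) \<le> 1 / 2\<close> norm_triangle_ineq4[of 1 y] by (intro mult_mono) auto
      finally have "norm y \<le> 1" by simp
      then show ?case using norm_pow[of r'] r by (simp add: y_def)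
    qed
  qed
  \<comment> \<open>Two steps of length \<open>1/m\<close> fit into \<open>\<delta>\<close>: boundedness reaches \<open>(k + 2)/m\<close>,
    so that convergence to \<open>0\<close> holds at the smaller radius \<open>(k + 1)/m\<close>.\<close>
  obtain m :: nat where m: "m > 0" "2 / real m < \<delta>"
  proof -
    obtain m :: nat where "2 / \<delta> < real m" using reals_Archimedean2 by blast
    moreover have "m > 0"
    proof (rule ccontr)
      assume "\<not> m > 0"
      with \<open>2 / \<delta> < real m\<close> \<open>\<delta> > 0\<close> show False by (simp add: field_simps)
    qed
    ultimately show ?thesis using \<open>\<delta> > 0\<close> by (intro that[of m]) (auto simp: field_simps)
  qed
  have lim: "(\<lambda>n. (real k / real m) ^ n * norm (x ^ n)) \<longlonglongrightarrow> 0" if "k < m" for k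
    using that
  proof (induction k)
    case 0
    have "\<forall>\<^sub>F n in sequentially. (0::real) ^ n * norm (x ^ n) = 0"
      using eventually_ge_at_top[of 1] by eventually_elim auto
    then show ?case by (simp add: tendsto_eventually)
  next
    case (Suc k)
    define r' where "r' = real (k + 2) / real m"
    have r': "real k / real m \<le> r'" "r' \<le> 1" "r' - real k / real m < \<delta>" "r' > 0"
      using Suc.prems m by (auto simp: r'_def field_simps)
    have ev: "\<forall>\<^sub>F n in sequentially. r' ^ n * norm (x ^ n) \<le> 1"
      using Suc r' by (intro step[of "real k / real m"]) auto
    define q where "q = real (Suc k) / real (k + 2)"
    have q: "0 \<le> q" "q < 1" "real (Suc k) / real m = q * r'"
      by (simp_all add: q_def r'_def)
    show ?case
    proof (rule Lim_null_comparison)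
      show "\<forall>\<^sub>F n in sequentially. norm ((real (Suc k) / real m) ^ n * norm (x ^ n)) \<le> q ^ n"
        using ev
      proof eventually_elim
        case (elim n)
        have "q ^ n * (r' ^ n * norm (x ^ n)) \<le> q ^ n * 1"
          using elim q by (intro mult_left_mono) auto
        then show ?case using q r' by (simp add: power_mult_distrib mult.assoc)
      qed
      show "(\<lambda>n. q ^ n) \<longlonglongrightarrow> 0"
        using q by (intro LIMSEQ_power_zero) simp
    qed
  qed
  have "\<forall>\<^sub>F n in sequentially. 1 ^ n * norm (x ^ n) \<le> 1"
  proof (rule step)
    show "(\<lambda>n. (real (m - 1) / real m) ^ n * norm (x ^ n)) \<longlonglongrightarrow> 0"
      using m by (intro lim) auto
    have "1 / real m < \<delta>"
      using m \<open>\<delta> > 0\<close> by (simp add: field_simps)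
    then show "1 - real (m - 1) / real m < \<delta>"
      using m by (simp add: of_nat_diff field_simps)
  qed (use m in auto)
  then have "Bseq (\<lambda>n. x ^ n)"
    by (intro Bseq_eventually_mono[of "\<lambda>n. x ^ n" "\<lambda>_. 1 :: real"]) (auto simp: Bseq_def intro!: exI[of _ 1])
  then show ?thesis using that by (auto simp: Bseq_def)
qed

lemma abs_gbinomial_neg_half_le_1: "\<bar>(- 1 / 2 :: real) gchoose k\<bar> \<le> 1"
proof (induction k)
  case (Suc k)
  have "real (Suc k) * ((- 1 / 2) gchoose Suc k) = (- 1 / 2 - real k) * ((- 1 / 2) gchoose k)"
    using gbinomial_absorption[of k "- 1 / 2 :: real"] gbinomial_absorb_comp[of "- 1 / 2 :: real" k] by simp
  then have "real (Suc k) * \<bar>(- 1 / 2) gchoose Suc k\<bar> = (1 / 2 + real k) * \<bar>(- 1 / 2) gchoose k\<bar>"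
    by (metis (no_types, lifting) abs_mult abs_of_nat abs_minus_cancel add.commute minus_add_distrib
        minus_divide_left uminus_add_conv_diff abs_of_nonneg add_nonneg_nonneg of_nat_0_le_iff
        zero_le_divide_1_iff zero_le_numeral)
  also have "\<dots> \<le> real (Suc k) * 1"
    using Suc by (intro mult_mono) auto
  finally show ?case by simp
qed simp

text \<open>
  The witness is the binomial series with exponent \<open>-1/2\<close> in \<open>y\<close>, whose coefficients
  have absolute value at most \<open>1\<close>; the factor \<open>2\<close> in the hypothesis makes it converge
  geometrically.  By the Vandermonde identity its square is the binomial series with exponent
  \<open>-1\<close>, the geometric series of \<open>- y\<close>.
\<close>
lemma inverse_square_root_exists:
  fixes y :: "'a::complex_banach_algebra_1"
  assumes "\<And>k. norm (((2::real) *\<^sub>R y) ^ k) \<le> C"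
  obtains w where "w * w * (1 + y) = 1"
    and "\<And>z. z * y = y * z \<Longrightarrow> z * w = w * z"
    and "\<And>f :: 'a \<Rightarrow>\<^sub>L 'b::complex_banach_algebra_1. unital_banach_hom f \<Longrightarrow> f y = 0 \<Longrightarrow> f w = 1"
proof -
  define u where "u = (\<lambda>k. (- 1 / 2 :: real) gchoose k)"
  define t where "t = (\<lambda>k. u k *\<^sub>R y ^ k)"
  define w where "w = (\<Sum>k. t k)"
  have y_le: "norm (y ^ k) \<le> C * (1 / 2) ^ k" for k
  proof -
    have "2 ^ k * norm (y ^ k) \<le> C"
      using assms[of k] by (simp add: scaleR_power)
    then show ?thesis by (simp add: field_simps power_divide)
  qed
  have geo: "summable (\<lambda>k. C * (1 / 2) ^ k)"
    by (intro summable_mult summable_geometric) simp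
  have norm_t: "summable (\<lambda>k. norm (t k))"
  proof (rule summable_comparison_test'[OF geo])
    fix k
    have "\<bar>u k\<bar> * norm (y ^ k) \<le> 1 * norm (y ^ k)"
      unfolding u_def by (intro mult_right_mono abs_gbinomial_neg_half_le_1) simp
    with y_le[of k] show "norm (norm (t k)) \<le> C * (1 / 2) ^ k"
      by (simp add: t_def)
  qed
  have t: "t sums w"
    unfolding w_def using summable_norm_cancel[OF norm_t] by (rule summable_sums)
  show ?thesis
  proof (rule that)
    have "(\<lambda>k. \<Sum>i\<le>k. t i * t (k - i)) sums (w * w)"
      unfolding w_def by (rule Cauchy_product_sums[OF norm_t norm_t])
    moreover have "(\<Sum>i\<le>k. t i * t (k - i)) = (- y) ^ k" for k
    proof -
      have "(\<Sum>i\<le>k. t i * t (k - i)) = (\<Sum>i\<le>k. u i * u (k - i)) *\<^sub>R y ^ k"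
        by (simp add: t_def scaleR_left.sum power_add[symmetric] mult.commute)
      also have "(\<Sum>i\<le>k. u i * u (k - i)) = (- 1) gchoose k"
        using gbinomial_Vandermonde[of "- 1 / 2 :: real" "- 1 / 2" k] by (simp add: u_def atLeast0AtMost)
      also have "\<dots> = (- 1) ^ k"
        using gbinomial_minus[of "1 :: real" k] by (simp add: binomial_gbinomial[symmetric])
      also have "(- 1) ^ k *\<^sub>R y ^ k = (- y) ^ k"
        by (metis scaleR_minus1_left scaleR_power)
      finally show ?thesis .
    qed
    ultimately have "(\<lambda>k. (- y) ^ k) sums (w * w)" by simp
    then have "(\<lambda>k. (- y) ^ k * (1 + y)) sums (w * w * (1 + y))"
      by (rule sums_mult2)
    moreover have "(\<lambda>k. (- y) ^ k - (- y) ^ Suc k) sums ((- y) ^ 0 - 0)"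
      using \<open>(\<lambda>k. (- y) ^ k) sums (w * w)\<close>
      by (intro telescope_sums' summable_LIMSEQ_zero) (rule sums_summable)
    moreover have "(- y) ^ k * (1 + y) = (- y) ^ k - (- y) ^ Suc k" for k
      using power_commuting_commutes[of "- y" y k] by (simp add: distrib_left)
    ultimately show "w * w * (1 + y) = 1"
      using sums_unique2 by (simp del: power_Suc)
  next
    fix z assume z: "z * y = y * z"
    have "z * t k = t k * z" for k
    proof -
      have "z * y ^ k = y ^ k * z" using z by (metis power_commuting_commutes)
      then show ?thesis by (simp add: t_def)
    qed
    then show "z * w = w * z"
      using sums_mult[OF t, of z] sums_mult2[OF t, of z] by (metis (no_types, lifting) sums_cong sums_unique2)
  next
    fix f :: "'a \<Rightarrow>\<^sub>L 'b" assume f: "unital_banach_hom f" "f y = 0"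
    have pow: "f (y ^ k) = f y ^ k" for k
      using f(1) by (induction k) (auto simp: unital_banach_hom_def)
    have "(\<lambda>k. f (t k)) sums f w"
      by (rule bounded_linear.sums[OF blinfun.bounded_linear_right t])
    moreover have "f (t k) = (if k = 0 then 1 else 0)" for k
      by (simp add: t_def blinfun.scaleR_right pow f(2) power_0_left u_def)
    ultimately have "(\<lambda>k. if k = 0 then 1 else 0) sums f w" by simp
    moreover have "(\<lambda>k. if k = 0 then 1 else 0) sums (1::'b)"
      using sums_single[of 0 "\<lambda>_. 1::'b"] by simp
    ultimately show "f w = 1" by (rule sums_unique2)
  qed
qed

text \<open>
  Let \<open>y = 4 (x\<^sup>2 - x)\<close> and let \<open>w\<close> be the inverse square root of \<open>1 + y\<close>.  Then
  \<open>e = 1/2 + (x - 1/2) w\<close> is idempotent because \<open>(x - 1/2)\<^sup>2 = (1 + y) / 4\<close>.  Since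
  \<open>f\<close> maps \<open>y\<close> to \<open>0\<close>, hence \<open>w\<close> to \<open>1\<close>, it does not distinguish \<open>e\<close> from
  \<open>x\<close>.
\<close>
lemma idempotent_lift:
  fixes f :: "'a::complex_banach_algebra_1 \<Rightarrow>\<^sub>L 'b::complex_banach_algebra_1"
  assumes f: "unital_banach_hom f" "f x * f x = f x"
    and ker: "\<And>x. f x = 0 \<Longrightarrow> spectrum x = {0}"
  obtains e where "e * e = e" "f e = f x" "\<And>z. z * x = x * z \<Longrightarrow> z * e = e * z"
proof -
  define y where "y = (4::real) *\<^sub>R (x * x - x)"
  have "f y = 0" "f ((2::real) *\<^sub>R y) = 0"
    using f by (simp_all add: y_def blinfun.scaleR_right blinfun.diff_right unital_banach_hom_def)
  then have "spectrum ((2::real) *\<^sub>R y) \<subseteq> ball 0 1"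
    using ker by simp
  then obtain C where "\<And>k. norm (((2::real) *\<^sub>R y) ^ k) \<le> C"
    by (rule spectrum_in_unit_ball_imp_power_bounded) blast
  then obtain w where w: "w * w * (1 + y) = 1"
    and comm: "\<And>z. z * y = y * z \<Longrightarrow> z * w = w * z"
    and fw: "\<And>f :: 'a \<Rightarrow>\<^sub>L 'b. unital_banach_hom f \<Longrightarrow> f y = 0 \<Longrightarrow> f w = 1"
    by (rule inverse_square_root_exists) blast
  define h where "h = x - (1 / 2 :: real) *\<^sub>R 1"
  define e where "e = (1 / 2 :: real) *\<^sub>R 1 + h * w"
  have hh: "h * h = (1 / 4 :: real) *\<^sub>R (1 + y)"
    by (simp add: h_def y_def algebra_simps flip: scaleR_add_left)
  have yx: "z * y = y * z" if "z * x = x * z" for z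
  proof -
    have "z * (x * x) = x * x * z" by (metis that mult.assoc)
    with that show ?thesis by (simp add: y_def left_diff_distrib right_diff_distrib)
  qed
  have hz: "z * h = h * z" if "z * x = x * z" for z
    using that by (simp add: h_def left_diff_distrib right_diff_distrib)
  have hw: "h * w = w * h"
    by (intro comm yx) (simp add: h_def left_diff_distrib right_diff_distrib)
  have yw: "y * w = w * y" by (rule comm) simp
  have "h * w * (h * w) = h * h * (w * w)"
    by (metis hw mult.assoc)
  also have "\<dots> = (1 / 4 :: real) *\<^sub>R (w * w * (1 + y))"
    unfolding hh using yw by (simp add: distrib_left distrib_right) (metis mult.assoc)
  finally have hwhw: "h * w * (h * w) = (1 / 4 :: real) *\<^sub>R 1"
    by (simp only: w)
  show ?thesis
  proof (rule that)
    have "e * e = (1 / 4 :: real) *\<^sub>R 1 + ((1 / 2 :: real) *\<^sub>R (h * w) + (1 / 2 :: real) *\<^sub>R (h * w))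
        + h * w * (h * w)"
      by (simp add: e_def distrib_left distrib_right scaleR_add_right add_ac)
    also have "\<dots> = ((1 / 4 :: real) + 1 / 4) *\<^sub>R 1 + (1 / 2 + 1 / 2 :: real) *\<^sub>R (h * w)"
      unfolding hwhw scaleR_add_left by (simp only: add_ac)
    also have "\<dots> = e"
      by (simp add: e_def)
    finally show "e * e = e" .
    have "f e = (1 / 2 :: real) *\<^sub>R 1 + f h * f w"
      using f(1) by (simp add: e_def blinfun.add_right blinfun.scaleR_right unital_banach_hom_def)
    also have "\<dots> = f x"
      using f(1) fw[OF f(1) \<open>f y = 0\<close>]
      by (simp add: h_def blinfun.diff_right blinfun.scaleR_right unital_banach_hom_def)
    finally show "f e = f x" .
    fix z assume "z * x = x * z"
    then have "z * w = w * z" "z * h = h * z" using comm yx hz by auto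
    then have "z * (h * w) = h * w * z" by (metis mult.assoc)
    then show "z * e = e * z" by (simp add: e_def distrib_left distrib_right)
  qed
qed

lemma idempotent_eq_0:
  fixes g :: "'a::complex_banach_algebra_1"
  assumes "g * g = g" "spectrum g = {0}"
  shows "g = 0"
proof -
  have "1 \<notin> spectrum g" using assms(2) by simp
  then obtain y where "(1 - g) * y = 1"
    by (auto simp: spectrum_def)
  then have "g = g * ((1 - g) * y)" by simp
  also have "\<dots> = (g - g * g) * y" by (simp add: algebra_simps)
  finally show ?thesis using assms(1) by simp
qed

text \<open>
  Any preimage \<open>c\<close> of \<open>b\<close> yields elements \<open>lagrange_basis lam n i\<close> of \<open>c\<close> that are
  idempotent modulo the kernel, and correcting them one at a time keeps them commuting.  The
  remaining relations hold modulo the kernel and their defects are idempotents, so they hold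
  exactly: an idempotent with spectrum \<open>{0}\<close> vanishes.
\<close>
lemma lift_spectral_idempotents:
  fixes f :: "'a::complex_banach_algebra_1 \<Rightarrow>\<^sub>L 'b::complex_banach_algebra_1"
  assumes inj: "inj_on lam {1..n}" and "n \<ge> 1"
    and f: "unital_banach_hom f" "surj f"
    and ker: "\<And>x. f x = 0 \<Longrightarrow> spectrum x = {0}"
    and root: "alg_poly (\<Prod>i=1..n. [:- lam i, 1:]) b = 0"
  obtains e where "\<And>i. i \<in> {1..n} \<Longrightarrow> f (e i) = alg_poly (lagrange_basis lam n i) b"
    and "\<And>i. i \<in> {1..n} \<Longrightarrow> e i * e i = e i"
    and "\<And>i j. i \<in> {1..n} \<Longrightarrow> j \<in> {1..n} \<Longrightarrow> i \<noteq> j \<Longrightarrow> e i * e j = 0"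
    and "(\<Sum>i=1..n. e i) = 1"
proof -
  note b_idem = lagrange_idempotents[OF inj \<open>n \<ge> 1\<close> root]
  obtain c where c: "f c = b" using \<open>surj f\<close> by (metis surjD)
  define x where "x = (\<lambda>i. alg_poly (lagrange_basis lam n i) c)"
  have fx: "f (x i) = alg_poly (lagrange_basis lam n i) b" for i
    by (simp add: x_def unital_banach_hom_alg_poly[OF f(1)] c)
  have "\<exists>e. e * e = e \<and> f e = f (x i) \<and> (\<forall>z. z * x i = x i * z \<longrightarrow> z * e = e * z)"
    if "i \<in> {1..n}" for i
  proof -
    have "f (x i) * f (x i) = f (x i)" unfolding fx by (rule b_idem(1)[OF that])
    then obtain e where "e * e = e" "f e = f (x i)" "\<And>z. z * x i = x i * z \<Longrightarrow> z * e = e * z"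
      using idempotent_lift[OF f(1) _ ker] by metis
    then show ?thesis by blast
  qed
  then obtain e where e: "\<And>i. i \<in> {1..n} \<Longrightarrow> e i * e i = e i"
    "\<And>i. i \<in> {1..n} \<Longrightarrow> f (e i) = f (x i)"
    "\<And>i z. i \<in> {1..n} \<Longrightarrow> z * x i = x i * z \<Longrightarrow> z * e i = e i * z"
    by metis
  have comm: "e i * e j = e j * e i" if ij: "i \<in> {1..n}" "j \<in> {1..n}" for i j
  proof -
    have "c * x i = x i * c" unfolding x_def by (rule alg_poly_commute) simp
    then have "e i * c = c * e i" using e(3)[OF ij(1)] by simp
    then have "e i * x j = x j * e i" unfolding x_def by (rule alg_poly_commute)
    then show ?thesis by (rule e(3)[OF ij(2)])
  qed
  have f_mult: "f (y * z) = f y * f z" and f_one: "f 1 = 1" for y z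
    using f(1) by (auto simp: unital_banach_hom_def)
  have orth: "e i * e j = 0" if ij: "i \<in> {1..n}" "j \<in> {1..n}" "i \<noteq> j" for i j
  proof (rule idempotent_eq_0)
    show "e i * e j * (e i * e j) = e i * e j"
      by (metis e(1) comm ij(1,2) mult.assoc)
    have "f (e i * e j) = 0"
      unfolding f_mult e(2)[OF ij(1)] e(2)[OF ij(2)] fx by (rule b_idem(2)[OF ij])
    then show "spectrum (e i * e j) = {0}" by (rule ker)
  qed
  have "1 - (\<Sum>i=1..n. e i) = 0"
  proof (rule idempotent_eq_0)
    let ?s = "\<Sum>i=1..n. e i"
    have "?s * ?s = (\<Sum>i=1..n. e i * ?s)" by (rule sum_distrib_right)
    also have "\<dots> = ?s"
    proof (rule sum.cong)
      fix i assume i: "i \<in> {1..n}"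
      have "e i * ?s = e i * e i"
        unfolding sum_distrib_left
        by (rule sum_eq_single[OF _ i]) (simp_all add: orth[OF i _ not_sym] del: atLeastAtMost_iff)
      then show "e i * ?s = e i" by (simp only: e(1)[OF i])
    qed simp
    finally have "?s * ?s = ?s" .
    then show "(1 - ?s) * (1 - ?s) = 1 - ?s"
      by (simp only: left_diff_distrib right_diff_distrib mult_1_left mult_1_right) simp
    have "f (1 - ?s) = 1 - (\<Sum>i=1..n. alg_poly (lagrange_basis lam n i) b)"
      by (simp add: blinfun.diff_right blinfun.sum_right f_one e(2) fx)
    then have "f (1 - ?s) = 0"
      using b_idem(3) by simp
    then show "spectrum (1 - ?s) = {0}" by (rule ker)
  qed
  then have "(\<Sum>i=1..n. e i) = 1" by simp
  with e(1,2) orth fx show ?thesis by (intro that[of e]) auto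
qed

section \<open>Lifting roots of a polynomial\<close>

theorem theorem21:
  fixes n :: nat
    and lam :: "nat \<Rightarrow> complex"
    and p :: "complex poly"
    and U :: "complex set"
    and \<pi> :: "complex \<Rightarrow> ('a::complex_banach_algebra_1 \<Rightarrow>\<^sub>L 'b::complex_banach_algebra_1)"
    and b :: "complex \<Rightarrow> 'b"
  assumes "n \<ge> 2"
    and "inj_on lam {1..n}"
    and "p = (\<Prod>i=1..n. [:- lam i, 1:])"
    and "open U" and "0 \<in> U"
    and "\<pi> vec_analytic_on U"
    and "\<forall>z\<in>U. unital_banach_hom (\<pi> z)"
    and "surj (blinfun_apply (\<pi> 0))"
    and "\<forall>x. blinfun_apply (\<pi> 0) x = 0 \<longrightarrow> spectrum x = {0}"
    and "b vec_analytic_on U"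
    and "\<forall>z\<in>U. b z \<in> alg_roots p"
  shows "\<exists>V (a :: complex \<Rightarrow> 'a).
    open V \<and> 0 \<in> V \<and> V \<subseteq> U \<and> a vec_analytic_on V \<and> (\<forall>z\<in>V. a z \<in> alg_roots p) \<and>
    (\<forall>z\<in>V. blinfun_apply (\<pi> z) (a z) = b z)"
proof -
  have hom: "unital_banach_hom (\<pi> z)" if "z \<in> U" for z
    using assms(7) that by blast
  have \<pi>_mult: "\<pi> z (x * y) = \<pi> z x * \<pi> z y" and \<pi>_scaleC: "\<pi> z (c *\<^sub>C x) = c *\<^sub>C \<pi> z x"
    and \<pi>_one: "\<pi> z 1 = 1" if "z \<in> U" for z c x y
    using hom[OF that] by (auto simp: unital_banach_hom_def)
  have "n \<ge> 1" using \<open>n \<ge> 2\<close> by simp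
  have b_root: "alg_poly (\<Prod>i=1..n. [:- lam i, 1:]) (b z) = 0" if "z \<in> U" for z
    using assms(3,11) that by (simp add: alg_roots_def)
  define f where "f = (\<lambda>i z. alg_poly (lagrange_basis lam n i) (b z))"
  have f_apply: "alg_poly (lagrange_basis lam n i) (b z) = f i z" for i z
    by (simp add: f_def)
  note f_idem = lagrange_idempotents[OF \<open>inj_on lam {1..n}\<close> \<open>n \<ge> 1\<close> b_root, unfolded f_apply]
  have ker: "spectrum x = {0}" if "\<pi> 0 x = 0" for x
    using assms(9) that by blast
  obtain e where \<pi>e: "\<And>i. i \<in> {1..n} \<Longrightarrow> \<pi> 0 (e i) = f i 0"
    and e: "\<And>i. i \<in> {1..n} \<Longrightarrow> e i * e i = e i"
      "\<And>i j. i \<in> {1..n} \<Longrightarrow> j \<in> {1..n} \<Longrightarrow> i \<noteq> j \<Longrightarrow> e i * e j = 0"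
      "(\<Sum>i=1..n. e i) = 1"
    by (rule lift_spectral_idempotents[OF \<open>inj_on lam {1..n}\<close> \<open>n \<ge> 1\<close> hom[OF \<open>0 \<in> U\<close>] assms(8) ker
          b_root[OF \<open>0 \<in> U\<close>], unfolded f_apply], assumption, rule that)
  define a0 where "a0 = (\<Sum>i=1..n. lam i *\<^sub>C e i)"
  have a0_root: "alg_poly p a0 = 0"
    unfolding assms(3) by (rule alg_poly_sum_idempotents(1)[OF _ _ e(3) a0_def]) (fact e(1), fact e(2))
  have e_a0: "e i * a0 = lam i *\<^sub>C e i" if "i \<in> {1..n}" for i
    by (rule alg_poly_sum_idempotents(2)[OF _ _ e(3) a0_def that]) (fact e(1), fact e(2))
  define S where "S = (\<lambda>z. \<Sum>i=1..n. f i z * \<pi> z (e i))"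

  \<comment> \<open>Two families of complete orthogonal idempotents that agree at \<open>z = 0\<close> are intertwined by
    the sum of the products of their members, which is \<open>1\<close> there.\<close>
  have S_intertwines: "b z * S z = S z * \<pi> z a0" if z: "z \<in> U" for z
  proof -
    have "b z * (f i z * \<pi> z (e i)) = f i z * \<pi> z (e i) * \<pi> z a0" if i: "i \<in> {1..n}" for i
    proof -
      have "b z * (f i z * \<pi> z (e i)) = lam i *\<^sub>C (f i z * \<pi> z (e i))"
        using f_idem(4)[OF z i] by (metis mult.assoc mult_scaleC_left)
      also have "\<dots> = f i z * \<pi> z (e i * a0)"
        unfolding e_a0[OF i] by (simp add: \<pi>_scaleC[OF z] mult_scaleC_right)
      finally show ?thesis by (simp add: \<pi>_mult[OF z] mult.assoc)
    qed
    then show ?thesis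
      unfolding S_def sum_distrib_left sum_distrib_right by (intro sum.cong) auto
  qed
  have "S 0 = (\<Sum>i=1..n. f i 0)"
    unfolding S_def by (rule sum.cong) (simp_all only: \<pi>e f_idem(1)[OF \<open>0 \<in> U\<close>])
  then have "S 0 = 1"
    using f_idem(3)[OF \<open>0 \<in> U\<close>] by simp
  have "\<pi> vec_analytic_on {0}" "b vec_analytic_on {0}"
    using assms(6,10) \<open>0 \<in> U\<close> by (auto elim!: vec_analytic_on_subset)
  then have S_analytic: "S vec_analytic_on {0}"
    unfolding S_def f_def
    by (intro vec_analytic_on_sum vec_analytic_on_mult vec_analytic_on_alg_poly
        vec_analytic_on_bounded_linear[of "\<lambda>P. blinfun_apply P _"] blinfun.bounded_linear_left)
      (auto simp: scaleC_blinfun.rep_eq)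
  obtain r s where "r > 0" and s_analytic: "s vec_analytic_on ball 0 r" and "s 0 = 1"
    and \<pi>s: "\<And>z. z \<in> ball 0 r \<Longrightarrow> \<pi> z (s z) = S z"
  proof (rule vec_analytic_lift[OF \<open>\<pi> vec_analytic_on {0}\<close> S_analytic \<open>open U\<close> \<open>0 \<in> U\<close> \<pi>_scaleC assms(8)])
    show "\<pi> 0 1 = S 0"
      using \<open>S 0 = 1\<close> \<pi>_one[OF \<open>0 \<in> U\<close>] by simp
  qed (assumption, rule that)
  have s_analytic_0: "s vec_analytic_on {0}"
    using s_analytic \<open>r > 0\<close> by (auto elim!: vec_analytic_on_subset)
  \<comment> \<open>Multiplications by \<open>s z\<close> are analytic families as well, and bijective at \<open>z = 0\<close>.\<close>
  have "(\<lambda>z. blinfun_mult_right (s z)) vec_analytic_on {0}"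
    by (rule vec_analytic_on_bounded_linear[OF bounded_linear_blinfun_mult_right _ s_analytic_0])
      (auto intro!: blinfun_eqI simp: scaleC_blinfun.rep_eq mult_scaleC_left)
  then obtain r1 x where "r1 > 0" and x: "\<And>z. z \<in> ball 0 r1 \<Longrightarrow> s z * x z = 1"
  proof (rule vec_analytic_lift[OF _ vec_analytic_on_const open_UNIV UNIV_I])
    show "surj (blinfun_apply (blinfun_mult_right (s 0)))" "blinfun_mult_right (s 0) 1 = 1"
      by (simp_all add: \<open>s 0 = 1\<close> surj_def)
  qed (simp add: mult_scaleC_right, rule that, assumption, simp)
  have "(\<lambda>z. blinfun_mult_left (s z)) vec_analytic_on {0}"
    by (rule vec_analytic_on_bounded_linear[OF bounded_linear_blinfun_mult_left _ s_analytic_0])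
      (auto intro!: blinfun_eqI simp: scaleC_blinfun.rep_eq mult_scaleC_right)
  moreover have "(\<lambda>z. s z * a0) vec_analytic_on {0}"
    by (intro vec_analytic_on_mult s_analytic_0 vec_analytic_on_const)
  ultimately obtain r2 a where "r2 > 0" and a_analytic: "a vec_analytic_on ball 0 r2"
    and a: "\<And>z. z \<in> ball 0 r2 \<Longrightarrow> a z * s z = s z * a0"
  proof (rule vec_analytic_lift[OF _ _ open_UNIV UNIV_I])
    show "surj (blinfun_apply (blinfun_mult_left (s 0)))" "blinfun_mult_left (s 0) a0 = s 0 * a0"
      by (simp_all add: \<open>s 0 = 1\<close> surj_def)
  qed (simp add: mult_scaleC_left, rule that, assumption+, simp)
  define V where "V = U \<inter> ball 0 r \<inter> ball 0 r1 \<inter> ball 0 r2"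
  have V: "z \<in> U" "z \<in> ball 0 r" "z \<in> ball 0 r1" "z \<in> ball 0 r2" if "z \<in> V" for z
    using that by (auto simp: V_def)
  show ?thesis
  proof (intro exI conjI ballI)
    show "open V" using \<open>open U\<close> by (simp add: V_def open_Int)
    show "0 \<in> V" using \<open>0 \<in> U\<close> \<open>r > 0\<close> \<open>r1 > 0\<close> \<open>r2 > 0\<close> by (simp add: V_def)
    show "V \<subseteq> U" by (auto simp: V_def)
    show "a vec_analytic_on V"
      using a_analytic by (rule vec_analytic_on_subset) (auto simp: V_def)
    fix z assume z: "z \<in> V"
    have "alg_poly p (a z) * s z = s z * alg_poly p a0"
      by (rule alg_poly_conj) (rule a[OF V(4)[OF z]])
    then have "alg_poly p (a z) * (s z * x z) = 0"
      by (simp add: a0_root mult.assoc[symmetric])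
    then show "a z \<in> alg_roots p"
      by (simp add: x[OF V(3)[OF z]] alg_roots_def)
    have "\<pi> z (a z) * S z = b z * S z"
      by (metis S_intertwines V(1,2,4) \<pi>_mult \<pi>s a z)
    moreover have "S z * \<pi> z (x z) = 1"
      by (metis V(1,2,3) \<pi>_mult \<pi>_one \<pi>s x z)
    ultimately show "\<pi> z (a z) = b z"
      by (metis mult.assoc mult.right_neutral)
  qed
qed

end
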